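(* Suppose that (A1) for all $b,b'\in\mathcal B$, $\phi(b,t)-\phi(b',t)$ is single-crossing in $t$ and $v(b,t)-v(b',t)$ is monotonic in $t$; and (A2) for all $a,a'\in\Delta(\mathcal B)$, $\phi(a,t)-\phi(a',t)$ is single-crossing in $t$. Let $b^{root}\in\mathcal B$ satisfy: (R1) $\{b^{root}\}=\operatorname{argmax}_{\tilde b}Q(\tilde b)$; and (R2) for every $b\in\mathcal B$ that does not contain $b^{root}$ (i.e. $b\not\supseteq b^{root}$), $v(b,\bar t)<v(b^{root},\bar t)$. Suppose also that for all $b_1,b_2$ with $b^{root}\subseteq b_1\subsetneq b_2\subseteq b^*$ one has $v(b_1,\bar t)<v(b_2,\bar t)$, where $b^*=\{1,\dots,n\}$ is the grand bundle. The minimal optimal menu of the monopolist's problem is a tree menu if 1. $|\{\tilde b\in\mathcal B: b^{root}\subsetneq\tilde b\subsetneq b^*\}|\ge 2$, and 2. there exists a function $\mathfrak f:[0,1]\to[0,1]$ that is increasing and strictly convex such that for every $\tilde b$ with $b^{root}\subsetneq\tilde b\subsetneq b^*$, $$\frac{\phi(\tilde b,\underline t)-\phi(b^{root},\underline t)}{\phi(b^*,\underline t)-\phi(b^{root},\underline t)}=\mathfrak f\!\left(\frac{\phi(\tilde b,\bar t)-\phi(b^{root},\bar t)}{\phi(b^*,\bar t)-\phi(b^{root},\bar t)}\right).$$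
   Context: Setup. There are $n$ goods; $\mathcal B=2^{\{1,\dots,n\}}$ is the set of (deterministic) bundles and $\Delta(\mathcal B)$ is the set of probability distributions on $\mathcal B$ (stochastic bundles); a bundle $b$ is identified with the point mass at $b$. Types $t$ lie in $T=[\underline t,\bar t]\subseteq\mathbb R$ and are distributed according to $F$ with a continuous, positive density $f$. The value function $v:\Delta(\mathcal B)\times T\to\mathbb R$ is continuously differentiable in $t$, with $v(\emptyset,t)=0$ for all $t$ and $v(a,t)=\mathbb E_{b\sim a}[v(b,t)]$. The virtual value function is $\phi(b,t)=v(b,t)-\frac{1-F(t)}{f(t)}v_t(b,t)$, $v_t=\partial v/\partial t$, extended by $\phi(a,t)=\mathbb E_{b\sim a}[\phi(b,t)]$ for $a\in\Delta(\mathcal B)$; note $\phi(b,\bar t)=v(b,\bar t)$. Standing assumptions: for $b\ne b'$ in $\mathcal B$ there is $t\in T$ with $\phi(b,t)\neq\phi(b',t)$; $\max_{b\neq\emptyset}\phi(b,\underline t)<0=\phi(\emptyset,\underline t)$; and $v(b,\bar t)>0$ for all $b\ne\emptyset$. Sold-alone quantity. The sold-alone quantity of a bundle $b$ is $Q(b)=1-F(t_b)\in[0,1]$, where $t_b\in T$ satisfies $\phi(b,t_b)=0$; it is the quantity sold by a revenue-maximizing monopolist who sells only $b$. For $b\neq\emptyset$ such a $t_b$ exists by the standing assumptions and continuity of $\phi$ (it is unique if, for example, the single-crossing in (A1) holds in the strict sense). Terminology. A function $g:T\to\mathbb R$ is single-crossing in $t$ if $\operatorname{sign}[g(t)]\in\{-1,0,1\}$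 is a monotonic function of $t$. "Monotonic" means either (weakly) increasing or (weakly) decreasing on $T$. Monopolist's problem. A mechanism is a measurable map $(a,p):T\to\Delta(\mathcal B)\times\mathbb R$. It is IC if $v(a(t),t)-p(t)\ge v(a(t'),t)-p(t')$ for all $t,t'\in T$, and IR if $v(a(t),t)-p(t)\ge 0$ for all $t\in T$. The monopolist maximizes $\mathbb E[p(t)]$ over IC and IR mechanisms. A menu $B\subseteq\mathcal B$ is optimal if there is an optimal mechanism $(a,p)$ with $a(t)\in B$ for all $t$; an optimal menu $B$ is a minimal optimal menu if no $B'\subsetneq B$ is optimal. (Under (A1) and (A2) the minimal optimal menu is unique.) A menu $\{b_1,\dots,b_m\}$ is a tree menu if (1) there is $i$ with $b_i\ne\emptyset$ and $b_i\subseteq b_j$ for every $b_j\neq\emptyset$ in the menu, and (2) there are $k,l$ with $b_k\not\subseteq b_l$ and $b_l\not\subseteq b_k$.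
   Formalization: The formal statement additionally requires 𝔣(0)=0 (normalization at b^root), without which the claim is false; if t_b is not unique, one zero is fixed as a function of the zero set of φ(b,·), and the argmax of Q is taken over nonempty bundles. *)

theory Defs
  imports "HOL-Probability.Probability"
begin

text \<open>
  The goods are the elements of a finite type \<open>'g\<close>, so bundles are sets of type \<open>'g set\<close>, the grand
  bundle is \<open>UNIV\<close>, and stochastic bundles are probability mass functions of type \<open>'g set pmf\<close>, the
  bundle \<open>b\<close> being identified with \<open>return_pmf b\<close>.
\<close>

record 'g screening =
  type_lo :: real
  type_hi :: real
  type_density :: "real \<Rightarrow> real"
  val :: "'g set \<Rightarrow> real \<Rightarrow> real"

definition types :: "'g screening \<Rightarrow> real set" where
  "types E = {type_lo E..type_hi E}"

definition type_cdf :: "'g screening \<Rightarrow> real \<Rightarrow> real" where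
  "type_cdf E t = (LINT s:{type_lo E..t}|lborel. type_density E s)"

text \<open>The derivative is taken within the type interval, hence one-sided at its endpoints.\<close>

definition val_deriv :: "'g screening \<Rightarrow> 'g set \<Rightarrow> real \<Rightarrow> real" where
  "val_deriv E b t = vector_derivative (val E b) (at t within types E)"

definition virtual_val :: "'g screening \<Rightarrow> 'g set \<Rightarrow> real \<Rightarrow> real" where
  "virtual_val E b t =
     val E b t - (1 - type_cdf E t) / type_density E t * val_deriv E b t"

text \<open>The extension of a function of deterministic bundles to stochastic bundles.\<close>

definition lottery :: "('g set \<Rightarrow> real \<Rightarrow> real) \<Rightarrow> 'g set pmf \<Rightarrow> real \<Rightarrow> real" where
  "lottery g a t = measure_pmf.expectation a (\<lambda>b. g b t)"

definition screening_env :: "'g::finite screening \<Rightarrow> bool" where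
  "screening_env E \<longleftrightarrow>
     type_lo E < type_hi E \<and>
     continuous_on (types E) (type_density E) \<and>
     (\<forall>t\<in>types E. type_density E t > 0) \<and>
     type_cdf E (type_hi E) = 1 \<and>
     (\<forall>b. (\<forall>t\<in>types E. (val E b has_real_derivative val_deriv E b t) (at t within types E)) \<and>
          continuous_on (types E) (val_deriv E b)) \<and>
     (\<forall>t\<in>types E. val E {} t = 0) \<and>
     (\<forall>b b'. b \<noteq> b' \<longrightarrow> (\<exists>t\<in>types E. virtual_val E b t \<noteq> virtual_val E b' t)) \<and>
     (\<forall>b. b \<noteq> {} \<longrightarrow> virtual_val E b (type_lo E) < 0) \<and>
     (\<forall>b. b \<noteq> {} \<longrightarrow> val E b (type_hi E) > 0)"

definition monotonic_on :: "real set \<Rightarrow> (real \<Rightarrow> real) \<Rightarrow> bool" where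
  "monotonic_on T g \<longleftrightarrow> mono_on T g \<or> antimono_on T g"

definition single_crossing_on :: "real set \<Rightarrow> (real \<Rightarrow> real) \<Rightarrow> bool" where
  "single_crossing_on T g \<longleftrightarrow> monotonic_on T (\<lambda>t. sgn (g t))"

definition strictly_convex_on :: "real set \<Rightarrow> (real \<Rightarrow> real) \<Rightarrow> bool" where
  "strictly_convex_on S g \<longleftrightarrow>
     (\<forall>x\<in>S. \<forall>y\<in>S. \<forall>u. x \<noteq> y \<and> 0 < u \<and> u < 1 \<longrightarrow>
        g ((1 - u) * x + u * y) < (1 - u) * g x + u * g y)"

text \<open>
  Under weak single-crossing the virtual value of \<open>b\<close> may vanish on an interval of types; the
  description operator then selects one of its zeros, as a function of the zero set only, so that
  bundles with the same zeros have the same sold-alone quantity. The value is meaningful for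
  \<open>b \<noteq> {}\<close> only: the virtual value of the empty bundle vanishes at every type. Accordingly the
  maximisers below range over the nonempty bundles.
\<close>

definition sold_alone :: "'g screening \<Rightarrow> 'g set \<Rightarrow> real" where
  "sold_alone E b = 1 - type_cdf E (SOME t. t \<in> types E \<and> virtual_val E b t = 0)"

definition argmax_sold_alone :: "'g screening \<Rightarrow> 'g set set" where
  "argmax_sold_alone E =
     {b. b \<noteq> {} \<and> (\<forall>b'. b' \<noteq> {} \<longrightarrow> sold_alone E b' \<le> sold_alone E b)}"

text \<open>
  Mechanisms are considered on the type interval only. Measurability into the simplex of
  stochastic bundles is measurability of every coordinate.
\<close>

definition mechanism ::
    "'g::finite screening \<Rightarrow> (real \<Rightarrow> 'g set pmf) \<Rightarrow> (real \<Rightarrow> real) \<Rightarrow> bool" where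
  "mechanism E a p \<longleftrightarrow>
     (\<forall>b. (\<lambda>t. pmf (a t) b) \<in> borel_measurable (restrict_space borel (types E))) \<and>
     p \<in> borel_measurable (restrict_space borel (types E))"

definition incentive_compatible ::
    "'g screening \<Rightarrow> (real \<Rightarrow> 'g set pmf) \<Rightarrow> (real \<Rightarrow> real) \<Rightarrow> bool" where
  "incentive_compatible E a p \<longleftrightarrow>
     (\<forall>t\<in>types E. \<forall>t'\<in>types E.
        lottery (val E) (a t) t - p t \<ge> lottery (val E) (a t') t - p t')"

definition individually_rational ::
    "'g screening \<Rightarrow> (real \<Rightarrow> 'g set pmf) \<Rightarrow> (real \<Rightarrow> real) \<Rightarrow> bool" where
  "individually_rational E a p \<longleftrightarrow> (\<forall>t\<in>types E. lottery (val E) (a t) t - p t \<ge> 0)"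

definition feasible ::
    "'g::finite screening \<Rightarrow> (real \<Rightarrow> 'g set pmf) \<Rightarrow> (real \<Rightarrow> real) \<Rightarrow> bool" where
  "feasible E a p \<longleftrightarrow>
     mechanism E a p \<and> incentive_compatible E a p \<and> individually_rational E a p"

text \<open>
  Payments of a feasible mechanism are bounded on the type interval, so the integral exists.
\<close>

definition revenue :: "'g screening \<Rightarrow> (real \<Rightarrow> real) \<Rightarrow> real" where
  "revenue E p = (LINT t:types E|lborel. p t * type_density E t)"

definition optimal_mechanism ::
    "'g::finite screening \<Rightarrow> (real \<Rightarrow> 'g set pmf) \<Rightarrow> (real \<Rightarrow> real) \<Rightarrow> bool" where
  "optimal_mechanism E a p \<longleftrightarrow>
     feasible E a p \<and> (\<forall>a' p'. feasible E a' p' \<longrightarrow> revenue E p' \<le> revenue E p)"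

definition optimal_menu :: "'g::finite screening \<Rightarrow> 'g set set \<Rightarrow> bool" where
  "optimal_menu E B \<longleftrightarrow>
     (\<exists>a p. optimal_mechanism E a p \<and> (\<forall>t\<in>types E. \<exists>b\<in>B. a t = return_pmf b))"

definition minimal_optimal_menu :: "'g::finite screening \<Rightarrow> 'g set set \<Rightarrow> bool" where
  "minimal_optimal_menu E B \<longleftrightarrow> optimal_menu E B \<and> (\<forall>B'. B' \<subset> B \<longrightarrow> \<not> optimal_menu E B')"

definition tree_menu :: "'g set set \<Rightarrow> bool" where
  "tree_menu B \<longleftrightarrow>
     (\<exists>b\<in>B. b \<noteq> {} \<and> (\<forall>b'\<in>B. b' \<noteq> {} \<longrightarrow> b \<subseteq> b')) \<and>
     (\<exists>b\<in>B. \<exists>b'\<in>B. \<not> b \<subseteq> b' \<and> \<not> b' \<subseteq> b)"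

end

theory Submission
  imports Defs
begin

text \<open>
  Write \<open>x b\<close> and \<open>y b\<close> for the virtual values of \<open>b\<close> at the lowest and the highest type. By (A2) a
  linear combination of virtual values that vanishes at both end types vanishes identically, so
  \<open>\<phi> b t = lam t * x b + mu t * y b\<close> with nonnegative weights, and the direction
  \<open>(lam t, mu t)\<close> sweeps the whole quadrant. Maximising the virtual value thus means moving along
  the upper right boundary of a planar set of points: (R1) says that the root is the first point
  met after the origin (the empty bundle), (R2) and (R1) that bundles not containing the root lie
  strictly inside, and strict convexity of \<open>g\<close> that every bundle containing the root is an exposed
  point. Hence each of \<open>{}\<close> and the bundles containing the root is the unique maximiser on an
  interval of types and belongs to every optimal menu. Conversely the pointwise maximisation over
  this menu is implementable, because whenever the chosen bundle changes from \<open>b\<close> to \<open>b'\<close> as the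
  type increases, \<open>v b' - v b\<close> is increasing by (A1).
\<close>

section \<open>Increments of functions supported from below\<close>

text \<open>
  A weak fundamental theorem of calculus for a Lipschitz function that need not be known to be
  differentiable; the difference quotients of \<open>W\<close> are compared with \<open>q\<close> under the integral.
\<close>

lemma integral_le_increment:
  fixes W q :: "real \<Rightarrow> real"
  assumes "a < b"
    and lip: "\<And>s t. s \<in> {a..b} \<Longrightarrow> t \<in> {a..b} \<Longrightarrow> \<bar>W s - W t\<bar> \<le> L * \<bar>s - t\<bar>"
    and q: "q integrable_on {a..b}"
    and qK: "\<And>t. t \<in> {a..b} \<Longrightarrow> \<bar>q t\<bar> \<le> K"
    and support: "\<And>t. t \<in> {a..b} \<Longrightarrow>
      \<exists>H. (H has_real_derivative q t) (at t within {a..b}) \<and> (\<forall>s\<in>{a..b}. H s - H t \<le> W s - W t)"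
  shows "integral {a..b} q \<le> W b - W a"
proof -
  \<comment> \<open>Clamping the argument keeps \<open>V\<close> Lipschitz on the whole line, so
    forward quotients make sense up to \<open>b\<close>.\<close>
  define V where "V t = W (min b (max a t))" for t
  have L0: "0 \<le> L"
    using lip[of a b] \<open>a < b\<close> by (auto dest!: order_trans[OF abs_ge_zero] simp: zero_le_mult_iff)
  have lipV: "\<bar>V s - V t\<bar> \<le> L * \<bar>s - t\<bar>" for s t
  proof -
    have "\<bar>V s - V t\<bar> \<le> L * \<bar>min b (max a s) - min b (max a t)\<bar>"
      unfolding V_def using \<open>a < b\<close> by (intro lip) auto
    also have "\<dots> \<le> L * \<bar>s - t\<bar>"
      using L0 by (intro mult_left_mono) (auto simp: min_def max_def)
    finally show ?thesis .
  qed
  have "L-lipschitz_on UNIV V"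
    using lipV L0 by (auto intro!: lipschitz_onI simp: dist_real_def)
  then have contV: "continuous_on A V" for A
    using lipschitz_on_continuous_on continuous_on_subset by blast
  define D where "D n t = real (Suc n) * (V (t + 1 / real (Suc n)) - V t)" for n t
  have contD: "continuous_on A (D n)" for A n
    unfolding D_def
    by (intro continuous_intros continuous_on_compose2[OF contV[of UNIV]]) auto
  have DL: "\<bar>D n t\<bar> \<le> L" for n t
  proof -
    have "\<bar>D n t\<bar> \<le> real (Suc n) * (L * \<bar>1 / real (Suc n)\<bar>)"
      unfolding D_def abs_mult using lipV[of "t + 1 / real (Suc n)" t]
      by (intro mult_mono) auto
    then show ?thesis by simp
  qed
  \<comment> \<open>Support from below bounds the forward quotients only from below, so they may
    fail to converge to \<open>q\<close>. Their minimum with \<open>q\<close> does converge, and it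
    is dominated by \<open>max L K\<close>.\<close>
  define m where "m n t = min (D n t) (q t)" for n t
  have qabs: "q absolutely_integrable_on {a..b}"
    by (rule absolutely_integrable_integrable_bound[where g="\<lambda>_. K"]) (use q qK in auto)
  have mabs: "m n absolutely_integrable_on {a..b}" for n
    unfolding m_def
    by (intro absolutely_integrable_min_1 absolutely_integrable_continuous_real contD qabs)
  have mint: "m n integrable_on {a..b}" for n
    using mabs set_lebesgue_integral_eq_integral(1) by blast
  \<comment> \<open>Interior points only: at \<open>b\<close> the clamped forward quotients are
    zero.\<close>
  have lim: "(\<lambda>n. m n t) \<longlonglongrightarrow> q t" if t: "t \<in> {a<..<b}" for t
  proof -
    from support[of t] t obtain H where
      H: "(H has_real_derivative q t) (at t within {a..b})"
      and HW: "\<And>s. s \<in> {a..b} \<Longrightarrow> H s - H t \<le> W s - W t"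
      by auto
    have "at t within {a..b} = at t"
      using t by (intro at_within_Icc_at) auto
    with H have "((\<lambda>h. (H (t + h) - H t) / h) \<longlongrightarrow> q t) (at 0)"
      by (simp add: DERIV_def)
    moreover have "filterlim (\<lambda>n. 1 / real (Suc n)) (at 0) sequentially"
      using LIMSEQ_Suc[OF lim_1_over_n[where ?'a=real]] by (auto simp: filterlim_at)
    ultimately have g: "(\<lambda>n. (H (t + 1 / real (Suc n)) - H t) / (1 / real (Suc n))) \<longlonglongrightarrow> q t"
      by (rule filterlim_compose)
    have lo: "(\<lambda>n. min ((H (t + 1 / real (Suc n)) - H t) / (1 / real (Suc n))) (q t)) \<longlonglongrightarrow> q t"
      using tendsto_min[OF g tendsto_const[of "q t"]] by simp
    have "\<forall>\<^sub>F n in sequentially. 1 / real (Suc n) < b - t"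
      using LIMSEQ_Suc[OF lim_1_over_n[where ?'a=real]] t by (intro order_tendstoD) auto
    then have "\<forall>\<^sub>F n in sequentially.
        min ((H (t + 1 / real (Suc n)) - H t) / (1 / real (Suc n))) (q t) \<le> m n t"
    proof eventually_elim
      case (elim n)
      let ?s = "t + 1 / real (Suc n)"
      have s: "?s \<in> {a..b}"
        using elim t by (auto simp: add_increasing2 less_imp_le)
      then have "V ?s = W ?s" "V t = W t"
        using t by (auto simp: V_def)
      then have "(H ?s - H t) / (1 / real (Suc n)) \<le> D n t"
        using HW[OF s] unfolding D_def by (simp add: mult.commute mult_left_mono del: of_nat_Suc)
      then show ?case by (auto simp: m_def)
    qed
    then show ?thesis
      by (intro tendsto_sandwich[OF _ _ lo tendsto_const]) (auto simp: m_def)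
  qed
  have "(\<lambda>n. integral {a<..<b} (m n)) \<longlonglongrightarrow> integral {a<..<b} q"
  proof (rule dominated_convergence(2)[where h="\<lambda>_. max L K"])
    show "m n integrable_on {a<..<b}" for n
      using mint[of n] by (simp add: integrable_on_open_interval_real)
    show "norm (m n t) \<le> max L K" if "t \<in> {a<..<b}" for n t
      using DL[of n t] qK[of t] that by (auto simp: m_def min_def max_def)
  qed (use lim in \<open>auto simp: integrable_on_open_interval_real\<close>)
  then have limm: "(\<lambda>n. integral {a..b} (m n)) \<longlonglongrightarrow> integral {a..b} q"
    by (simp add: integral_open_interval_real)
  \<comment> \<open>An antiderivative of \<open>V\<close> turns the integral of a quotient into the
    mean of \<open>V\<close> just right of \<open>b\<close> minus its mean just right of
    \<open>a\<close>; continuity of \<open>V\<close> gives the limit.\<close>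
  define G where "G x = integral {a..x} V" for x
  have Gderiv: "((\<lambda>n. (G (x + 1 / real (Suc n)) - G x) / (1 / real (Suc n))) \<longlonglongrightarrow> V x)"
    if "x \<in> {a..b}" for x
  proof -
    \<comment> \<open>The upper end \<open>b + 1\<close> leaves room for steps of length at most 1
      to the right of \<open>b\<close>.\<close>
    have "(G has_real_derivative V x) (at x within {a..b + 1})"
      unfolding G_def using that by (intro integral_has_real_derivative contV) auto
    then have "(G has_real_derivative V x) (at x within {x..b + 1})"
      by (rule has_field_derivative_subset) (use that in auto)
    then have "((\<lambda>y. (G y - G x) / (y - x)) \<longlongrightarrow> V x) (at x within {x..b + 1})"
      by (simp add: has_field_derivative_iff)
    moreover have "filterlim (\<lambda>n. x + 1 / real (Suc n)) (at x within {x..b + 1}) sequentially"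
      unfolding filterlim_at
    proof
      show "(\<lambda>n. x + 1 / real (Suc n)) \<longlonglongrightarrow> x"
        using tendsto_add[OF tendsto_const LIMSEQ_Suc[OF lim_1_over_n[where ?'a=real]], of x] by simp
      show "\<forall>\<^sub>F n in sequentially. x + 1 / real (Suc n) \<in> {x..b + 1} \<and> x + 1 / real (Suc n) \<noteq> x"
        using that by (intro always_eventually allI conjI) (auto intro!: add_mono simp del: of_nat_Suc)
    qed
    ultimately have "(\<lambda>n. (G (x + 1 / real (Suc n)) - G x) / (x + 1 / real (Suc n) - x)) \<longlonglongrightarrow> V x"
      by (rule filterlim_compose)
    then show ?thesis by simp
  qed
  have intD: "integral {a..b} (D n) =
    (G (b + 1 / real (Suc n)) - G b) / (1 / real (Suc n)) - (G (a + 1 / real (Suc n)) - G a) / (1 / real (Suc n))" for n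
  proof -
    let ?h = "1 / real (Suc n)"
    have vi: "V integrable_on {x..y}" for x y
      by (rule integrable_continuous_interval[OF contV])
    have "integral {a..b} (\<lambda>t. V (t + ?h)) = integral {a + ?h..b + ?h} V"
      using integral_shift_real_ivl[of "a + ?h" ?h "b + ?h" V] by simp
    moreover have "G (a + ?h) + integral {a + ?h..b + ?h} V = G (b + ?h)"
      unfolding G_def by (rule Henstock_Kurzweil_Integration.integral_combine[OF _ _ vi]) (use \<open>a < b\<close> in auto)
    moreover have "G a = 0" by (simp add: G_def)
    moreover have "integral {a..b} (D n) = real (Suc n) * (integral {a..b} (\<lambda>t. V (t + ?h)) - G b)"
      unfolding D_def G_def
      by (subst integral_mult_right, subst integral_diff)
        (auto intro!: vi integrable_continuous_interval continuous_on_compose2[OF contV[of UNIV]] continuous_intros)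
    ultimately have "integral {a..b} (D n) = real (Suc n) * (G (b + ?h) - G (a + ?h) - G b)" "G a = 0"
      by (simp_all add: eq_diff_eq del: of_nat_Suc)
    then show ?thesis by (simp add: algebra_simps del: of_nat_Suc)
  qed
  have "(\<lambda>n. integral {a..b} (D n)) \<longlonglongrightarrow> V b - V a"
    unfolding intD using \<open>a < b\<close> by (intro tendsto_diff Gderiv) auto
  moreover have "integral {a..b} (m n) \<le> integral {a..b} (D n)" for n
    by (rule integral_le[OF mint integrable_continuous_interval[OF contD]]) (auto simp: m_def)
  ultimately have "integral {a..b} q \<le> V b - V a"
    using limm by (intro LIMSEQ_le) auto
  then show ?thesis using \<open>a < b\<close> by (simp add: V_def)
qed

text \<open>Support from below survives the reflection of the argument, which flips the sign of the
  derivative. The inequality for the reflected function is the reverse inequality for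
  \<open>W\<close>.\<close>

lemma integral_eq_increment:
  fixes W q :: "real \<Rightarrow> real"
  assumes "a < b"
    and lip: "\<And>s t. s \<in> {a..b} \<Longrightarrow> t \<in> {a..b} \<Longrightarrow> \<bar>W s - W t\<bar> \<le> L * \<bar>s - t\<bar>"
    and q: "q integrable_on {a..b}"
    and qK: "\<And>t. t \<in> {a..b} \<Longrightarrow> \<bar>q t\<bar> \<le> K"
    and support: "\<And>t. t \<in> {a..b} \<Longrightarrow>
      \<exists>H. (H has_real_derivative q t) (at t within {a..b}) \<and> (\<forall>s\<in>{a..b}. H s - H t \<le> W s - W t)"
  shows "integral {a..b} q = W b - W a"
proof (rule antisym)
  show "integral {a..b} q \<le> W b - W a"
    by (rule integral_le_increment[OF assms])
  have "integral {- b..- a} (\<lambda>t. - q (- t)) \<le> W (- (- a)) - W (- (- b))"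
  proof (rule integral_le_increment)
    show "- b < - a" using \<open>a < b\<close> by simp
    show "\<bar>W (- s) - W (- t)\<bar> \<le> L * \<bar>s - t\<bar>" if "s \<in> {- b..- a}" "t \<in> {- b..- a}" for s t
      using lip[of "- s" "- t"] that by (simp add: abs_minus_commute)
    show "(\<lambda>t. - q (- t)) integrable_on {- b..- a}"
      using q by (intro integrable_neg) simp
    show "\<bar>- q (- t)\<bar> \<le> K" if "t \<in> {- b..- a}" for t
      using qK[of "- t"] that by simp
    fix t assume t: "t \<in> {- b..- a}"
    then obtain H where H: "(H has_real_derivative q (- t)) (at (- t) within {a..b})"
      and HW: "\<And>s. s \<in> {a..b} \<Longrightarrow> H s - H (- t) \<le> W s - W (- t)"
      using support[of "- t"] by auto
    have "((\<lambda>s. H (- s)) has_real_derivative - q (- t)) (at t within {- b..- a})"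
    proof -
      have "uminus ` {- b..- a} = {a..b}" by (simp add: image_uminus_atLeastAtMost)
      then have "(H has_real_derivative q (- t)) (at (- t) within uminus ` {- b..- a})"
        using H by simp
      moreover have "(uminus has_real_derivative - 1) (at t within {- b..- a})"
        by (auto intro!: derivative_eq_intros)
      ultimately show ?thesis
        using DERIV_image_chain by (fastforce simp: o_def)
    qed
    then show "\<exists>H. (H has_real_derivative - q (- t)) (at t within {- b..- a}) \<and>
        (\<forall>s\<in>{- b..- a}. H s - H t \<le> W (- s) - W (- t))"
      using HW by (intro exI[of _ "\<lambda>s. H (- s)"]) auto
  qed
  then show "W b - W a \<le> integral {a..b} q" by simp
qed

section \<open>Revenue and virtual surplus\<close>

lemma set_integrable_bounded_borel:
  fixes h :: "real \<Rightarrow> real"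
  assumes "h \<in> borel_measurable (restrict_space borel {a..b})"
    and "\<And>t. t \<in> {a..b} \<Longrightarrow> \<bar>h t\<bar> \<le> K"
  shows "set_integrable lborel {a..b} h"
proof (rule set_integrable_bound)
  show "set_integrable lborel {a..b} (\<lambda>_. K)"
    by (intro borel_integrable_atLeastAtMost' continuous_intros)
  show "set_borel_measurable lborel {a..b} h"
    using assms(1) unfolding set_borel_measurable_def
    by (subst (asm) borel_measurable_restrict_space_iff) auto
  show "AE x in lborel. x \<in> {a..b} \<longrightarrow> norm (h x) \<le> norm K"
    using assms(2) by (intro always_eventually) (auto intro: order_trans[OF _ abs_ge_self])
qed

section \<open>Expected values under lotteries over finitely many bundles\<close>

lemma lottery_eq_sum: "lottery g a t = (\<Sum>b\<in>UNIV. pmf a b * g b t)"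
  for a :: "'g::finite set pmf"
  unfolding lottery_def
  by (subst integral_measure_pmf_real[where A=UNIV]) (auto simp: mult.commute)

lemma lottery_return [simp]: "lottery g (return_pmf b) t = g b t"
  by (simp add: lottery_def)

lemma lottery_le:
  fixes a :: "'g::finite set pmf"
  assumes "\<And>b. g b t \<le> K"
  shows "lottery g a t \<le> K"
proof -
  have "lottery g a t \<le> (\<Sum>b\<in>UNIV. pmf a b * K)"
    unfolding lottery_eq_sum using assms by (intro sum_mono mult_left_mono) auto
  also have "\<dots> = K"
    by (simp add: sum_distrib_right[symmetric] sum_pmf_eq_1)
  finally show ?thesis .
qed

lemma lottery_diff_abs_le:
  fixes a :: "'g::finite set pmf"
  assumes "\<And>b. \<bar>g b s - g b t\<bar> \<le> K"
  shows "\<bar>lottery g a s - lottery g a t\<bar> \<le> K"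
proof -
  have "lottery g a s - lottery g a t = lottery (\<lambda>b _. g b s - g b t) a t"
       "lottery g a t - lottery g a s = lottery (\<lambda>b _. g b t - g b s) a t"
    by (simp_all add: lottery_eq_sum sum_subtractf right_diff_distrib)
  moreover have "lottery (\<lambda>b _. g b s - g b t) a t \<le> K" "lottery (\<lambda>b _. g b t - g b s) a t \<le> K"
    using assms by (auto intro!: lottery_le simp: abs_le_iff)
  ultimately show ?thesis by linarith
qed

lemma lottery_abs_le:
  fixes a :: "'g::finite set pmf"
  assumes "\<And>b. \<bar>g b t\<bar> \<le> K"
  shows "\<bar>lottery g a t\<bar> \<le> K"
  \<comment> \<open>The comparison function vanishes at \<open>t + 1\<close>, so the bound on
    differences becomes a bound on values.\<close>
  using lottery_diff_abs_le[of "\<lambda>b s. if s = t then g b t else 0" t "t + 1" K a] assms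
  by (simp add: lottery_eq_sum)

lemma lottery_has_real_derivative:
  fixes a :: "'g::finite set pmf"
  assumes "\<And>b. (g b has_real_derivative g' b t) (at t within S)"
  shows "(lottery g a has_real_derivative lottery g' a t) (at t within S)"
  unfolding lottery_eq_sum by (intro DERIV_sum DERIV_cmult assms)

section \<open>Distribution, values and virtual values on the type interval\<close>

locale screening =
  fixes E :: "'g::finite screening"
  assumes env: "screening_env E"
begin

abbreviation "lo \<equiv> type_lo E"
abbreviation "hi \<equiv> type_hi E"
abbreviation "T \<equiv> types E"
abbreviation "dens \<equiv> type_density E"
abbreviation "F \<equiv> type_cdf E"
abbreviation "v \<equiv> val E"
abbreviation "v' \<equiv> val_deriv E"
abbreviation "\<phi> \<equiv> virtual_val E"

lemma T_eq: "T = {lo..hi}"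
  by (simp add: types_def)

lemma lo_less_hi: "lo < hi"
  using env by (simp add: screening_env_def)

lemma lo_in_T [simp]: "lo \<in> T" and hi_in_T [simp]: "hi \<in> T"
  using lo_less_hi by (auto simp: T_eq)

lemma dens_pos: "t \<in> T \<Longrightarrow> 0 < dens t"
  using env by (simp add: screening_env_def)

lemma continuous_on_dens: "continuous_on T dens"
  using env by (simp add: screening_env_def)

lemma F_hi: "F hi = 1"
  using env by (simp add: screening_env_def)

lemma v_deriv: "t \<in> T \<Longrightarrow> (v b has_real_derivative v' b t) (at t within T)"
  using env by (simp add: screening_env_def)

lemma continuous_on_v': "continuous_on T (v' b)"
  using env by (simp add: screening_env_def)

lemma continuous_on_v: "continuous_on T (v b)"
  using v_deriv by (meson DERIV_continuous_on)

lemma v_empty: "t \<in> T \<Longrightarrow> v {} t = 0"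
  using env by (simp add: screening_env_def)

lemma \<phi>_distinct: "b \<noteq> b' \<Longrightarrow> \<exists>t\<in>T. \<phi> b t \<noteq> \<phi> b' t"
  using env by (simp add: screening_env_def)

lemma \<phi>_lo_neg: "b \<noteq> {} \<Longrightarrow> \<phi> b lo < 0"
  using env by (simp add: screening_env_def)

lemma \<phi>_hi: "\<phi> b hi = v b hi"
  by (simp add: virtual_val_def F_hi)

lemma \<phi>_hi_pos: "b \<noteq> {} \<Longrightarrow> 0 < \<phi> b hi"
  using env by (simp add: screening_env_def \<phi>_hi)

lemma F_eq: "t \<in> T \<Longrightarrow> F t = integral {lo..t} dens"
  unfolding type_cdf_def
  by (intro set_borel_integral_eq_integral borel_integrable_atLeastAtMost'
      continuous_on_subset[OF continuous_on_dens]) (auto simp: T_eq)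

lemma F_lo: "F lo = 0"
  by (simp add: F_eq)

lemma F_deriv:
  assumes "t \<in> T" shows "(F has_real_derivative dens t) (at t within T)"
proof -
  have "((\<lambda>x. integral {lo..x} dens) has_real_derivative dens t) (at t within T)"
    using continuous_on_dens assms unfolding T_eq by (rule integral_has_real_derivative)
  then show ?thesis
    by (rule has_field_derivative_transform_within[where d=1]) (use assms F_eq in auto)
qed

lemma continuous_on_F: "continuous_on T F"
  using F_deriv by (meson DERIV_continuous_on)

lemma F_strict_mono:
  assumes "s \<in> T" "t \<in> T" "s < t" shows "F s < F t"
proof (rule DERIV_pos_imp_increasing_open[OF \<open>s < t\<close>])
  fix x assume x: "s < x" "x < t"
  then have "at x within T = at x"
    unfolding T_eq using assms by (intro at_within_Icc_at) (auto simp: T_eq)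
  with F_deriv[of x] dens_pos[of x] x assms show "\<exists>y. DERIV F x :> y \<and> y > 0"
    by (auto simp: T_eq)
next
  show "continuous_on {s..t} F"
    using assms by (intro continuous_on_subset[OF continuous_on_F]) (auto simp: T_eq)
qed

lemma F_bounds: "t \<in> T \<Longrightarrow> 0 \<le> F t \<and> F t \<le> 1"
  using F_strict_mono[of lo t] F_strict_mono[of t hi] F_lo F_hi
  by (cases "t = lo"; cases "t = hi") (auto simp: T_eq)

lemma continuous_on_\<phi>: "continuous_on T (\<phi> b)"
  unfolding virtual_val_def using dens_pos
  by (intro continuous_intros continuous_on_F continuous_on_v continuous_on_v' continuous_on_dens)
    (use less_irrefl in fastforce)

lemma \<phi>_empty:
  assumes "t \<in> T" shows "\<phi> {} t = 0"
proof -
  have "((\<lambda>_. 0) has_real_derivative v' {} t) (at t within T)"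
    by (rule has_field_derivative_transform_within[OF v_deriv[OF assms], where d=1])
      (use assms v_empty in auto)
  then have "v' {} t = 0"
    using vector_derivative_unique_within_closed_interval[of lo hi t "\<lambda>_. 0" "v' {} t" 0]
      lo_less_hi assms
    by (auto simp: T_eq has_real_derivative_iff_has_vector_derivative cbox_interval)
  then show ?thesis using assms by (simp add: virtual_val_def v_empty)
qed

text \<open>The sum of the absolute values over the finitely many bundles is continuous on a compact
  interval; its bound serves all bundles at once.\<close>

lemma bounded_family:
  fixes g :: "'g set \<Rightarrow> real \<Rightarrow> real"
  assumes "\<And>b. continuous_on T (g b)"
  obtains K where "0 \<le> K" "\<And>b t. t \<in> T \<Longrightarrow> \<bar>g b t\<bar> \<le> K"
proof -
  have "continuous_on T (\<lambda>t. \<Sum>b\<in>UNIV. \<bar>g b t\<bar>)"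
    by (intro continuous_intros assms)
  then have "bounded ((\<lambda>t. \<Sum>b\<in>UNIV. \<bar>g b t\<bar>) ` T)"
    unfolding T_eq by (intro compact_imp_bounded compact_continuous_image) auto
  then obtain K where K: "\<And>t. t \<in> T \<Longrightarrow> \<bar>\<Sum>b\<in>UNIV. \<bar>g b t\<bar>\<bar> \<le> K"
    unfolding bounded_iff by auto
  have "\<bar>g b t\<bar> \<le> K" if "t \<in> T" for b t
    using member_le_sum[of b UNIV "\<lambda>b. \<bar>g b t\<bar>"] K[OF that] by auto
  moreover from this[of lo] have "0 \<le> K"
    using abs_ge_zero order_trans lo_in_T by blast
  ultimately show thesis by (rule that[rotated])
qed

section \<open>Measurability and integrability along a mechanism\<close>

lemma measurable_T: "continuous_on T g \<Longrightarrow> g \<in> borel_measurable (restrict_space borel T)"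
  for g :: "real \<Rightarrow> real"
  by (rule borel_measurable_continuous_on_restrict)

lemma lottery_measurable:
  fixes a :: "real \<Rightarrow> 'g set pmf"
  assumes "\<And>b. (\<lambda>t. pmf (a t) b) \<in> borel_measurable (restrict_space borel T)"
    and "\<And>b. continuous_on T (g b)"
  shows "(\<lambda>t. lottery g (a t) t) \<in> borel_measurable (restrict_space borel T)"
  unfolding lottery_eq_sum
  by (intro borel_measurable_sum borel_measurable_times assms measurable_T)

lemma set_integrable_lottery:
  fixes a :: "real \<Rightarrow> 'g set pmf"
  assumes "\<And>b. (\<lambda>t. pmf (a t) b) \<in> borel_measurable (restrict_space borel T)"
    and "\<And>b. continuous_on T (g b)"
  shows "set_integrable lborel T (\<lambda>t. lottery g (a t) t)"
proof -
  obtain K where K: "\<And>b t. t \<in> T \<Longrightarrow> \<bar>g b t\<bar> \<le> K"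
    using bounded_family[of g, OF assms(2)] by metis
  have "\<bar>lottery g (a t) t\<bar> \<le> K" if "t \<in> T" for t
    by (intro lottery_abs_le K that)
  then show ?thesis
    using lottery_measurable[OF assms] unfolding T_eq by (intro set_integrable_bounded_borel)
qed

lemma surplus_integrable:
  assumes "feasible E a p"
  shows "set_integrable lborel T (\<lambda>t. lottery \<phi> (a t) t * dens t)"
proof -
  have "lottery (\<lambda>b t. \<phi> b t * dens t) (a t) t = lottery \<phi> (a t) t * dens t" for t
    by (simp add: lottery_eq_sum sum_distrib_right mult.assoc)
  then show ?thesis
    using set_integrable_lottery[of a "\<lambda>b t. \<phi> b t * dens t"] assms
    by (simp add: feasible_def mechanism_def continuous_intros continuous_on_\<phi> continuous_on_dens)
qed

text \<open>
  Incentive compatibility says that the indirect utility \<open>U\<close> is touched from below at \<open>t\<close> by the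
  utility from reporting \<open>t\<close>. Working with \<open>(1 - F) * U\<close> instead of \<open>U\<close> gives the envelope formula
  and the integration by parts in one step.
\<close>

lemma revenue_eq_virtual_surplus:
  assumes "feasible E a p"
  shows "revenue E p =
    (LINT t:T|lborel. lottery \<phi> (a t) t * dens t) - (lottery v (a lo) lo - p lo)"
proof -
  define U where "U t = lottery v (a t) t - p t" for t
  have meas: "(\<lambda>t. pmf (a t) b) \<in> borel_measurable (restrict_space borel T)" for b
    using assms by (simp add: feasible_def mechanism_def)
  obtain L where L: "0 \<le> L" "\<And>b t. t \<in> T \<Longrightarrow> \<bar>v' b t\<bar> \<le> L"
    using bounded_family[of v', OF continuous_on_v'] by metis
  obtain K where K: "0 \<le> K" "\<And>t. t \<in> T \<Longrightarrow> \<bar>dens t\<bar> \<le> K"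
    using bounded_family[of "\<lambda>_. dens", OF continuous_on_dens] by metis
  have supp: "lottery v (a t) s - lottery v (a t) t \<le> U s - U t" if "s \<in> T" "t \<in> T" for s t
    using assms that unfolding feasible_def incentive_compatible_def U_def by fastforce
  have "convex T" unfolding T_eq by simp
  have vlip: "\<bar>v b s - v b t\<bar> \<le> L * \<bar>s - t\<bar>" if "s \<in> T" "t \<in> T" for b s t
    using field_differentiable_bound[OF \<open>convex T\<close> v_deriv, of b L s t] L that by auto
  have lotlip: "\<bar>lottery v c s - lottery v c t\<bar> \<le> L * \<bar>s - t\<bar>" if "s \<in> T" "t \<in> T" for c s t
    using vlip that by (intro lottery_diff_abs_le)
  have Ulip: "\<bar>U s - U t\<bar> \<le> L * \<bar>s - t\<bar>" if "s \<in> T" "t \<in> T" for s t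
    using supp[of s t] supp[of t s] lotlip[OF that, of "a t"] lotlip[OF that, of "a s"] that
    by linarith
  have Flip: "\<bar>F s - F t\<bar> \<le> K * \<bar>s - t\<bar>" if "s \<in> T" "t \<in> T" for s t
    using field_differentiable_bound[OF \<open>convex T\<close> F_deriv, of K s t] K that by auto
  have "L-lipschitz_on T U"
    using Ulip L by (auto intro!: lipschitz_onI simp: dist_real_def)
  then have contU: "continuous_on T U"
    by (rule lipschitz_on_continuous_on)
  obtain M where M: "0 \<le> M" "\<And>t. t \<in> T \<Longrightarrow> \<bar>U t\<bar> \<le> M"
    using bounded_family[of "\<lambda>_. U", OF contU] by metis
  define W where "W t = (1 - F t) * U t" for t
  define q where "q t = (1 - F t) * lottery v' (a t) t - dens t * U t" for t
  \<comment> \<open>With the weight \<open>1 - F s\<close> taken at \<open>s\<close>, the utility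
    increment carries a nonnegative factor, so a lower bound for it passes to
    \<open>W\<close>.\<close>
  have Wdiff: "W s - W t = (1 - F s) * (U s - U t) - (F s - F t) * U t" for s t
    by (simp add: W_def algebra_simps)
  have Wlip: "\<bar>W s - W t\<bar> \<le> (L + K * M) * \<bar>s - t\<bar>" if "s \<in> T" "t \<in> T" for s t
  proof -
    have "\<bar>(1 - F s) * (U s - U t)\<bar> \<le> 1 * (L * \<bar>s - t\<bar>)"
      unfolding abs_mult using F_bounds[OF that(1)] Ulip[OF that] by (intro mult_mono) auto
    moreover have "\<bar>(F s - F t) * U t\<bar> \<le> (K * \<bar>s - t\<bar>) * M"
      unfolding abs_mult using Flip[OF that] M that K by (intro mult_mono) auto
    ultimately show ?thesis unfolding Wdiff by (simp add: algebra_simps)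
  qed
  have qbound: "\<bar>q t\<bar> \<le> L + K * M" if "t \<in> T" for t
  proof -
    have "\<bar>(1 - F t) * lottery v' (a t) t\<bar> \<le> 1 * L"
      unfolding abs_mult using F_bounds[OF that] L that
      by (intro mult_mono lottery_abs_le) auto
    moreover have "\<bar>dens t * U t\<bar> \<le> K * M"
      unfolding abs_mult using K M that by (intro mult_mono) auto
    ultimately show ?thesis unfolding q_def by linarith
  qed
  have "q \<in> borel_measurable (restrict_space borel T)"
    unfolding q_def
    by (intro borel_measurable_diff borel_measurable_times lottery_measurable meas)
      (intro measurable_T continuous_on_const contU continuous_on_F continuous_on_dens
        continuous_on_v')+
  then have qint: "set_integrable lborel T q"
    using qbound unfolding T_eq by (rule set_integrable_bounded_borel)
  have "integral {lo..hi} q = W hi - W lo"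
  proof (rule integral_eq_increment[where L="L + K * M" and K="L + K * M"])
    show "q integrable_on {lo..hi}"
      using set_borel_integral_eq_integral(1)[OF qint] by (simp add: T_eq)
    fix t assume "t \<in> {lo..hi}"
    then have t: "t \<in> T" by (simp add: T_eq)
    \<comment> \<open>The right side of \<open>Wdiff\<close> with \<open>U s - U t\<close> replaced
      by its lower bound, the utility increment under the fixed report \<open>t\<close>. Its
      derivative at \<open>t\<close> is \<open>q t\<close>.\<close>
    define H where
      "H s = (1 - F s) * (lottery v (a t) s - lottery v (a t) t) - (F s - F t) * U t" for s
    have "(H has_real_derivative
        (0 - dens t) * (lottery v (a t) t - lottery v (a t) t)
          + (lottery v' (a t) t - 0) * (1 - F t) - (dens t - 0) * U t) (at t within T)"
      unfolding H_def using t
      by (intro DERIV_diff DERIV_mult DERIV_cmult_right DERIV_const F_deriv v_deriv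
          lottery_has_real_derivative)
    then have "(H has_real_derivative q t) (at t within {lo..hi})"
      by (simp add: q_def T_eq mult.commute)
    moreover have "H s - H t \<le> W s - W t" if "s \<in> {lo..hi}" for s
      using supp[of s t] t that F_bounds[of s] unfolding Wdiff H_def
      by (auto simp: T_eq intro!: mult_left_mono)
    ultimately show "\<exists>H. (H has_real_derivative q t) (at t within {lo..hi}) \<and>
        (\<forall>s\<in>{lo..hi}. H s - H t \<le> W s - W t)"
      by blast
  qed (use lo_less_hi Wlip qbound in \<open>auto simp: T_eq\<close>)
  \<comment> \<open>\<open>W\<close> vanishes at \<open>hi\<close> because \<open>F hi = 1\<close>,
    and equals \<open>U\<close> at \<open>lo\<close> because \<open>F lo = 0\<close>.\<close>
  then have qlo: "(LINT t:T|lborel. q t) = - U lo"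
    using set_borel_integral_eq_integral(2)[OF qint] by (simp add: W_def F_lo F_hi T_eq)
  note \<phi>int = surplus_integrable[OF assms]
  have pt: "p t * dens t = lottery \<phi> (a t) t * dens t + q t" if "t \<in> T" for t
  proof -
    have "lottery \<phi> (a t) t = lottery v (a t) t - (1 - F t) / dens t * lottery v' (a t) t"
      by (simp add: lottery_eq_sum virtual_val_def sum_subtractf sum_distrib_left
          right_diff_distrib mult_ac)
    then show ?thesis
      using dens_pos[OF that] by (simp add: q_def U_def field_simps)
  qed
  have "T \<in> sets lborel" by (simp add: T_eq)
  then have "revenue E p = (LINT t:T|lborel. lottery \<phi> (a t) t * dens t + q t)"
    unfolding revenue_def by (rule set_lebesgue_integral_cong) (use pt in blast)
  also have "\<dots> = (LINT t:T|lborel. lottery \<phi> (a t) t * dens t) - U lo"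
    using set_integral_add(2)[OF \<phi>int qint] qlo by simp
  finally show ?thesis by (simp only: U_def)
qed

end

section \<open>Single-crossing and convexity\<close>

lemma single_crossing_on_sgn_cong:
  assumes "\<And>t. t \<in> S \<Longrightarrow> sgn (g t) = sgn (h t)"
  shows "single_crossing_on S g \<longleftrightarrow> single_crossing_on S h"
  unfolding single_crossing_on_def monotonic_on_def monotone_on_def using assms by auto

lemma single_crossing_on_between:
  assumes "single_crossing_on S h" "r \<in> S" "s \<in> S" "t \<in> S" "r \<le> s" "s \<le> t"
  shows "sgn (h r) \<le> sgn (h s) \<and> sgn (h s) \<le> sgn (h t) \<or>
         sgn (h t) \<le> sgn (h s) \<and> sgn (h s) \<le> sgn (h r)"
  using assms unfolding single_crossing_on_def monotonic_on_def monotone_on_def by blast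

text \<open>Slopes of chords ending at \<beta> are smaller than slopes of chords starting there, so
  a number separating the two families is the slope of a supporting line. Strict convexity at
  midpoints makes the support strict.\<close>

lemma strictly_convex_on_subgradient:
  assumes g: "strictly_convex_on {a..b} g" and \<beta>: "a < \<beta>" "\<beta> < b"
  obtains m where "\<And>z. z \<in> {a..b} \<Longrightarrow> z \<noteq> \<beta> \<Longrightarrow> g \<beta> + m * (z - \<beta>) < g z"
proof -
  define slope where "slope z = (g z - g \<beta>) / (z - \<beta>)" for z
  have chord: "slope x < slope z" if "x \<in> {a..b}" "z \<in> {a..b}" "x < \<beta>" "\<beta> < z" for x z
  proof -
    define u where "u = (\<beta> - x) / (z - x)"
    have u: "0 < u" "u < 1" using that by (auto simp: u_def)
    have "u * (z - x) = \<beta> - x" using that by (simp add: u_def)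
    then have \<beta>u: "(1 - u) * x + u * z = \<beta>" by (simp add: algebra_simps)
    have "g \<beta> < (1 - u) * g x + u * g z"
      using g u that unfolding strictly_convex_on_def \<beta>u[symmetric] by auto
    then have "(z - x) * g \<beta> < (z - x) * ((1 - u) * g x + u * g z)"
      using that by simp
    also have "\<dots> = ((z - x) - (u * (z - x))) * g x + (u * (z - x)) * g z"
      by (simp add: algebra_simps)
    also have "\<dots> = (z - \<beta>) * g x + (\<beta> - x) * g z"
      unfolding \<open>u * (z - x) = \<beta> - x\<close> by simp
    finally have "(g \<beta> - g x) * (z - \<beta>) < (g z - g \<beta>) * (\<beta> - x)"
      by (simp add: algebra_simps)
    then have "(g \<beta> - g x) / (\<beta> - x) < (g z - g \<beta>) / (z - \<beta>)"
      using that by (simp add: divide_simps)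
    then show ?thesis
      unfolding slope_def by (metis minus_diff_eq minus_divide_divide)
  qed
  \<comment> \<open>The supremum of the left chord slopes; \<open>slope b\<close> bounds it because
    \<beta> is interior.\<close>
  define m where "m = Sup (slope ` {a..<\<beta>})"
  have bdd: "bdd_above (slope ` {a..<\<beta>})"
    using chord[of _ b] \<beta> by (intro bdd_aboveI[of _ "slope b"]) (auto intro: less_imp_le)
  have left: "slope x \<le> m" if "x \<in> {a..<\<beta>}" for x
    unfolding m_def using bdd that by (intro cSup_upper) auto
  have right: "m \<le> slope z" if "z \<in> {\<beta><..b}" for z
    unfolding m_def using chord[of _ z] \<beta> that by (intro cSup_least) (auto intro: less_imp_le)
  have weak: "g \<beta> + m * (z - \<beta>) \<le> g z" if "z \<in> {a..b}" for z
  proof (cases z \<beta> rule: linorder_cases)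
    case less
    then show ?thesis
      using left[of z] that by (simp add: slope_def divide_le_eq split: if_splits)
  next
    case greater
    then show ?thesis
      using right[of z] that by (simp add: slope_def le_divide_eq split: if_splits)
  qed simp
  show thesis
  proof (rule that[of m])
    fix z assume z: "z \<in> {a..b}" "z \<noteq> \<beta>"
    \<comment> \<open>Equality at \<open>z\<close> would put the midpoint of \<beta> and
      \<open>z\<close> strictly below the supporting line.\<close>
    let ?w = "(1 - 1/2) * \<beta> + (1/2) * z"
    have "g \<beta> + m * (?w - \<beta>) \<le> g ?w"
      using z \<beta> by (intro weak) auto
    also have "g ?w < (1 - 1/2) * g \<beta> + (1/2) * g z"
      using g[unfolded strictly_convex_on_def, rule_format, of \<beta> z "1/2"] z \<beta> by auto
    finally show "g \<beta> + m * (z - \<beta>) < g z"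
      by (simp add: field_simps)
  qed
qed

lemma mono_on_imp_derivative_nonneg:
  fixes w :: "real \<Rightarrow> real"
  assumes "mono_on {a..b} w" "a < b" "t \<in> {a..b}"
    and "(w has_real_derivative D) (at t within {a..b})"
  shows "0 \<le> D"
proof (rule tendsto_lowerbound)
  show "((\<lambda>s. (w s - w t) / (s - t)) \<longlongrightarrow> D) (at t within {a..b})"
    using assms(4) by (simp add: has_field_derivative_iff)
  have "0 \<le> (w s - w t) / (s - t)" if "s \<in> {a..b}" for s
    using assms(1,3) that unfolding monotone_on_def
    by (cases "s \<le> t") (auto intro: divide_nonpos_nonpos)
  then show "\<forall>\<^sub>F s in at t within {a..b}. 0 \<le> (w s - w t) / (s - t)"
    unfolding eventually_at_filter by (auto intro: always_eventually)
  show "at t within {a..b} \<noteq> bot"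
    using assms(2,3) by (simp add: trivial_limit_within islimpt_Icc)
qed

lemma ex_lexicographic_max:
  fixes f g :: "'a \<Rightarrow> real"
  assumes "finite A" "A \<noteq> {}"
  shows "\<exists>b\<in>A. \<forall>b'\<in>A. f b' < f b \<or> f b' = f b \<and> g b' \<le> g b"
proof -
  have attained: "\<exists>b\<in>B. h b = Max (h ` B)" if "finite B" "B \<noteq> {}" for h :: "'a \<Rightarrow> real" and B
  proof -
    have "Max (h ` B) \<in> h ` B" using that by (intro Max_in) auto
    then obtain b where "Max (h ` B) = h b" "b \<in> B" by (rule imageE)
    then show ?thesis by (intro bexI[of _ b]) (rule sym)
  qed
  define A' where "A' = {b \<in> A. f b = Max (f ` A)}"
  have A': "finite A'" "A' \<noteq> {}"
    using assms attained[of A f] by (auto simp: A'_def)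
  then obtain b where b: "b \<in> A'" "g b = Max (g ` A')"
    using attained by blast
  have "f b' < f b \<or> f b' = f b \<and> g b' \<le> g b" if "b' \<in> A" for b'
  proof (cases "f b' = f b")
    case True
    then have "b' \<in> A'" using b that by (simp add: A'_def)
    then show ?thesis using True b A' by simp
  next
    case False
    moreover have "f b' \<le> f b"
      using b assms that by (simp add: A'_def)
    ultimately show ?thesis by simp
  qed
  moreover have "b \<in> A" using b by (simp add: A'_def)
  ultimately show ?thesis by blast
qed

text \<open>Since \<open>t0\<close> may be an end of \<open>{a..b}\<close>, the neighbourhood is cut
  to it; positive length remains, which later makes a loss of virtual surplus integrate to something
  positive.\<close>

lemma interval_of_eventually_within:
  fixes t0 :: real
  assumes "a < b" "t0 \<in> {a..b}" "\<forall>\<^sub>F t in at t0 within {a..b}. P t" "P t0"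
  obtains c d where "c < d" "{c..d} \<subseteq> {a..b}" "\<And>t. t \<in> {c..d} \<Longrightarrow> P t"
proof -
  from assms(3) obtain e where e: "e > 0" "\<And>t. t \<in> {a..b} \<Longrightarrow> t \<noteq> t0 \<Longrightarrow> dist t t0 < e \<Longrightarrow> P t"
    unfolding eventually_at by auto
  show thesis
  proof (rule that[of "max a (t0 - e/2)" "min b (t0 + e/2)"])
    fix t assume "t \<in> {max a (t0 - e/2)..min b (t0 + e/2)}"
    then have "t \<in> {a..b}" "dist t t0 < e" using e(1) by (auto simp: dist_real_def)
    then show "P t" using e(2) \<open>P t0\<close> by (cases "t = t0") auto
  qed (use assms(1,2) e(1) in auto)
qed

context screening
begin

text \<open>
  Since \<open>\<phi> {}\<close> vanishes, the empty bundle absorbs the mass needed to turn arbitrary weights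
  into a multiple of a difference of two lotteries.
\<close>

lemma single_crossing_combination:
  assumes A2: "\<forall>a a'. single_crossing_on T (\<lambda>t. lottery \<phi> a t - lottery \<phi> a' t)"
  shows "single_crossing_on T (\<lambda>t. \<Sum>b\<in>UNIV. c b * \<phi> b t)"
proof -
  define k where "k b = (if b = {} then - (\<Sum>b\<in>UNIV - {{}}. c b) else c b)" for b :: "'g set"
  define n where "n = real (card (UNIV :: 'g set set))"
  \<comment> \<open>Large enough to dominate every \<open>- k b\<close>, including the balancing
    weight of the empty bundle.\<close>
  define K where "K = 1 + (\<Sum>b\<in>UNIV. \<bar>c b\<bar>)"
  have n: "n > 0" by (simp add: n_def card_gt_0_iff)
  have K: "K > 0" by (simp add: K_def add_pos_nonneg sum_nonneg)
  have kK: "- k b \<le> K" for b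
  proof (cases "b = {}")
    case True
    have "(\<Sum>b\<in>UNIV - {{}}. c b) \<le> (\<Sum>b\<in>UNIV - {{}}. \<bar>c b\<bar>)" by (intro sum_mono) auto
    also have "\<dots> \<le> (\<Sum>b\<in>UNIV. \<bar>c b\<bar>)" by (intro sum_mono2) auto
    finally show ?thesis using True by (simp add: k_def K_def)
  next
    case False
    have "\<bar>c b\<bar> \<le> (\<Sum>b\<in>UNIV. \<bar>c b\<bar>)"
      by (rule member_le_sum) auto
    then show ?thesis using False by (simp add: k_def K_def)
  qed
  have "(\<Sum>b\<in>UNIV. k b) = k {} + (\<Sum>b\<in>UNIV - {{}}. k b)"
    by (rule sum.remove) auto
  also have "(\<Sum>b\<in>UNIV - {{}}. k b) = (\<Sum>b\<in>UNIV - {{}}. c b)"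
    by (intro sum.cong) (auto simp: k_def)
  finally have k0: "(\<Sum>b\<in>UNIV. k b) = 0" by (simp add: k_def)
  \<comment> \<open>A perturbation of the uniform lottery in the direction \<open>k\<close>. Its
    difference from the uniform lottery reproduces the given combination up to the positive factor
    \<open>1 / (n * K)\<close>.\<close>
  define f where "f b = 1 / n + k b / (n * K)" for b
  have f0: "0 \<le> f b" for b
  proof -
    have "f b = (K + k b) / (n * K)" using n K by (simp add: f_def field_simps)
    then show ?thesis using n K kK[of b] by simp
  qed
  have "(\<Sum>b\<in>UNIV. f b) = 1"
    using n k0 by (simp add: f_def sum.distrib sum_divide_distrib[symmetric] n_def)
  then have f1: "(\<integral>\<^sup>+b. ennreal (f b) \<partial>count_space UNIV) = 1"
    using f0 by (simp add: nn_integral_count_space_finite sum_ennreal)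
  define a where "a = embed_pmf f"
  have pa: "pmf a b = f b" for b
    unfolding a_def using f0 f1 by (rule pmf_embed_pmf)
  have pu: "pmf (pmf_of_set UNIV) b = 1 / n" for b :: "'g set"
    by (simp add: n_def)
  have "lottery \<phi> a t - lottery \<phi> (pmf_of_set UNIV) t = (\<Sum>b\<in>UNIV. c b * \<phi> b t) / (n * K)"
    if "t \<in> T" for t
  proof -
    have "lottery \<phi> a t - lottery \<phi> (pmf_of_set UNIV) t = (\<Sum>b\<in>UNIV. k b / (n * K) * \<phi> b t)"
      by (simp add: lottery_eq_sum pa pu f_def sum_subtractf[symmetric] distrib_right)
    also have "\<dots> = (\<Sum>b\<in>UNIV. c b * \<phi> b t / (n * K))"
      by (intro sum.cong) (auto simp: k_def \<phi>_empty[OF that])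
    finally show ?thesis by (simp add: sum_divide_distrib)
  qed
  then have "sgn (\<Sum>b\<in>UNIV. c b * \<phi> b t) = sgn (lottery \<phi> a t - lottery \<phi> (pmf_of_set UNIV) t)"
    if "t \<in> T" for t
    using that n K by (simp add: sgn_divide sgn_mult)
  then have "single_crossing_on T (\<lambda>t. \<Sum>b\<in>UNIV. c b * \<phi> b t) \<longleftrightarrow>
      single_crossing_on T (\<lambda>t. lottery \<phi> a t - lottery \<phi> (pmf_of_set UNIV) t)"
    by (rule single_crossing_on_sgn_cong)
  with A2 show ?thesis by blast
qed

end

section \<open>The two-dimensional representation of virtual values\<close>

text \<open>In the plane of virtual values at the two end types, \<open>g_between\<close> places the
  bundles strictly between the root and \<open>UNIV\<close> on a curve described by
  \<open>g\<close>; \<open>g_0\<close> makes this curve start at the root.\<close>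

locale tree_screening = screening E for E :: "'g::finite screening" +
  fixes root :: "'g set" and g :: "real \<Rightarrow> real"
  assumes single_crossing: "single_crossing_on T (\<lambda>t. \<phi> b t - \<phi> b' t)"
    and monotonic: "monotonic_on T (\<lambda>t. v b t - v b' t)"
    and lottery_single_crossing:
      "\<forall>a a'. single_crossing_on T (\<lambda>t. lottery \<phi> a t - lottery \<phi> a' t)"
    and root_argmax: "{root} = argmax_sold_alone E"
    and not_superset_less: "\<not> root \<subseteq> b \<Longrightarrow> v b hi < v root hi"
    and superset_less: "root \<subseteq> b1 \<Longrightarrow> b1 \<subset> b2 \<Longrightarrow> v b1 hi < v b2 hi"
    and card_between: "2 \<le> card {b. root \<subset> b \<and> b \<subset> UNIV}"
    and g_range: "z \<in> {0..1} \<Longrightarrow> g z \<in> {0..1}"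
    and g_0: "g 0 = 0"
    and g_convex: "strictly_convex_on {0..1} g"
    and g_between: "root \<subset> b \<Longrightarrow> b \<subset> UNIV \<Longrightarrow>
      (\<phi> b lo - \<phi> root lo) / (\<phi> UNIV lo - \<phi> root lo) =
      g ((\<phi> b hi - \<phi> root hi) / (\<phi> UNIV hi - \<phi> root hi))"
begin

abbreviation "x b \<equiv> \<phi> b lo"
abbreviation "y b \<equiv> \<phi> b hi"

lemma root_nonempty: "root \<noteq> {}"
  using root_argmax by (auto simp: argmax_sold_alone_def)

lemma root_less_UNIV: "root \<subset> UNIV"
proof -
  have "{b. root \<subset> b \<and> b \<subset> UNIV} \<noteq> {}"
    using card_between by (intro notI) simp
  then show ?thesis by blast
qed

lemma sold_alone_less:
  assumes "b \<noteq> {}" "b \<noteq> root" shows "sold_alone E b < sold_alone E root"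
proof -
  have "root \<in> argmax_sold_alone E" "b \<notin> argmax_sold_alone E"
    using root_argmax assms by auto
  moreover from this(2) obtain b' where "b' \<noteq> {}" "sold_alone E b < sold_alone E b'"
    using assms(1) by (auto simp: argmax_sold_alone_def not_le)
  ultimately show ?thesis
    unfolding argmax_sold_alone_def by (auto intro: less_le_trans)
qed

lemma single_crossing3:
  "single_crossing_on T (\<lambda>t. c1 * \<phi> b1 t + c2 * \<phi> b2 t + c3 * \<phi> b3 t)"
proof -
  \<comment> \<open>A sum of indicators, so that coefficients add up when some of the three bundles
    coincide.\<close>
  let ?c = "\<lambda>b. (if b = b1 then c1 else 0) + (if b = b2 then c2 else 0) + (if b = b3 then c3 else 0)"
  have "(\<Sum>b\<in>UNIV. ?c b * \<phi> b t) = c1 * \<phi> b1 t + c2 * \<phi> b2 t + c3 * \<phi> b3 t" for t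
    by (simp add: distrib_right sum.distrib if_distrib[of "\<lambda>c. c * _"] cong: if_cong)
  then show ?thesis
    using single_crossing_combination[OF lottery_single_crossing, of ?c] by simp
qed

lemma single_crossing2: "single_crossing_on T (\<lambda>t. c1 * \<phi> b1 t + c2 * \<phi> b2 t)"
  using single_crossing3[of c1 b1 c2 b2 0 b2] by simp

text \<open>The sign at \<open>t\<close> lies between the signs at the two ends, whatever the
  direction of monotonicity.\<close>

lemma single_crossing_endpoints:
  assumes h: "single_crossing_on T h" and t: "t \<in> T"
  shows "h lo = 0 \<Longrightarrow> h hi = 0 \<Longrightarrow> h t = 0"
    and "0 \<le> h lo \<Longrightarrow> 0 \<le> h hi \<Longrightarrow> 0 \<le> h t"
    and "0 < h lo \<Longrightarrow> 0 < h hi \<Longrightarrow> 0 < h t"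
  using single_crossing_on_between[OF h lo_in_T t hi_in_T] t
  by (auto simp: T_eq sgn_if split: if_splits)

text \<open>For points on one ray, \<open>y b' * \<phi> b t - y b * \<phi> b' t\<close> vanishes at
  both ends and hence throughout; both coefficients are nonzero.\<close>

lemma parallel_imp_same_zeros:
  assumes "b \<noteq> {}" "b' \<noteq> {}" "x b * y b' = x b' * y b" "t \<in> T"
  shows "\<phi> b t = 0 \<longleftrightarrow> \<phi> b' t = 0"
proof -
  have "y b' * \<phi> b t + (- y b) * \<phi> b' t = 0"
    by (rule single_crossing_endpoints(1)[OF single_crossing2 \<open>t \<in> T\<close>])
      (use assms in \<open>auto simp: algebra_simps\<close>)
  then show ?thesis
    using \<phi>_hi_pos[OF assms(1)] \<phi>_hi_pos[OF assms(2)] by auto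
qed

text \<open>The zero selected in \<open>sold_alone\<close> depends on the zero set alone, so points
  on one ray have equal sold-alone quantities, against the uniqueness in (R1).\<close>

lemma not_parallel_root:
  assumes "b \<noteq> {}" "b \<noteq> root"
  shows "x b * y root \<noteq> x root * y b"
proof
  assume "x b * y root = x root * y b"
  then have "t \<in> T \<and> \<phi> b t = 0 \<longleftrightarrow> t \<in> T \<and> \<phi> root t = 0" for t
    using parallel_imp_same_zeros[OF assms(1) root_nonempty] by blast
  then have "sold_alone E b = sold_alone E root"
    unfolding sold_alone_def by simp
  then show False using sold_alone_less[OF assms] by simp
qed

text \<open>The determinant of the points of the root and of \<open>UNIV\<close>. By Cramer's rule
  \<open>lam\<close> and \<open>mu\<close> solve
  \<open>\<phi> b t = lam t * x b + mu t * y b\<close> for these two bundles.\<close>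

definition "wedge = x root * y UNIV - x UNIV * y root"
definition "lam t = (y UNIV * \<phi> root t - y root * \<phi> UNIV t) / wedge"
definition "mu t = (x root * \<phi> UNIV t - x UNIV * \<phi> root t) / wedge"

lemma wedge_nonzero: "wedge \<noteq> 0"
proof -
  have "UNIV \<noteq> root" using root_less_UNIV by blast
  then have "x UNIV * y root \<noteq> x root * y UNIV"
    by (intro not_parallel_root) auto
  then show ?thesis by (simp add: wedge_def)
qed

text \<open>
  A combination of virtual values that vanishes at both ends of the type interval vanishes
  throughout, so the virtual values span a two-dimensional space.
\<close>

lemma \<phi>_eq:
  assumes "t \<in> T" shows "\<phi> b t = lam t * x b + mu t * y b"
proof -
  \<comment> \<open>The expanded 3 by 3 determinant with rows \<open>\<phi>\<close>,
    \<open>x\<close>, \<open>y\<close> and columns \<open>b\<close>, \<open>root\<close>,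
    \<open>UNIV\<close>; at each end type two rows agree.\<close>
  have "wedge * \<phi> b t + (x UNIV * y b - x b * y UNIV) * \<phi> root t
      + (x b * y root - x root * y b) * \<phi> UNIV t = 0"
    by (rule single_crossing_endpoints(1)[OF single_crossing3 assms])
      (simp_all add: wedge_def algebra_simps)
  moreover have "wedge * lam t = y UNIV * \<phi> root t - y root * \<phi> UNIV t"
    "wedge * mu t = x root * \<phi> UNIV t - x UNIV * \<phi> root t"
    using wedge_nonzero by (simp_all add: lam_def mu_def)
  then have "wedge * (lam t * x b + mu t * y b) =
      (y UNIV * \<phi> root t - y root * \<phi> UNIV t) * x b
      + (x root * \<phi> UNIV t - x UNIV * \<phi> root t) * y b"
    by (simp only: distrib_left mult.assoc[symmetric])
  ultimately have "wedge * \<phi> b t = wedge * (lam t * x b + mu t * y b)"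
    by (simp add: algebra_simps)
  then show ?thesis using wedge_nonzero by simp
qed

lemma lam_mu_ends: "lam lo = 1" "mu lo = 0" "lam hi = 0" "mu hi = 1"
  using wedge_nonzero by (simp_all add: lam_def mu_def wedge_def field_simps)

lemma lam_mu_single_crossing:
  "single_crossing_on T lam" "single_crossing_on T mu"
  "single_crossing_on T (\<lambda>t. lam t + mu t)"
proof -
  have "single_crossing_on T (\<lambda>t. (y UNIV / wedge) * \<phi> root t + (- y root / wedge) * \<phi> UNIV t)"
       "single_crossing_on T (\<lambda>t. (- x UNIV / wedge) * \<phi> root t + (x root / wedge) * \<phi> UNIV t)"
       "single_crossing_on T (\<lambda>t. ((y UNIV - x UNIV) / wedge) * \<phi> root t
          + ((x root - y root) / wedge) * \<phi> UNIV t)"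
    by (rule single_crossing2)+
  moreover have "(\<lambda>t. (y UNIV / wedge) * \<phi> root t + (- y root / wedge) * \<phi> UNIV t) = lam"
    "(\<lambda>t. (- x UNIV / wedge) * \<phi> root t + (x root / wedge) * \<phi> UNIV t) = mu"
    "(\<lambda>t. ((y UNIV - x UNIV) / wedge) * \<phi> root t + ((x root - y root) / wedge) * \<phi> UNIV t)
      = (\<lambda>t. lam t + mu t)"
    by (auto simp: fun_eq_iff lam_def mu_def add_divide_distrib diff_divide_distrib algebra_simps)
  ultimately show "single_crossing_on T lam" "single_crossing_on T mu"
    "single_crossing_on T (\<lambda>t. lam t + mu t)"
    by simp_all
qed

text \<open>The pair \<open>(lam, mu)\<close> runs from (1, 0) to (0, 1) with single-crossing
  coordinates; their sum is single-crossing too and equals 1 at both ends.\<close>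

lemma lam_nonneg: "t \<in> T \<Longrightarrow> 0 \<le> lam t"
  and mu_nonneg: "t \<in> T \<Longrightarrow> 0 \<le> mu t"
  and lam_mu_pos: "t \<in> T \<Longrightarrow> 0 < lam t + mu t"
  using single_crossing_endpoints(2)[OF lam_mu_single_crossing(1)]
    single_crossing_endpoints(2)[OF lam_mu_single_crossing(2)]
    single_crossing_endpoints(3)[OF lam_mu_single_crossing(3)] lam_mu_ends
  by auto

text \<open>The intermediate value theorem for \<open>mu t - k * lam t\<close>, which is
  \<open>- k\<close> at \<open>lo\<close> and 1 at \<open>hi\<close>. Strict maximisation at some
  type thus reduces to maximising \<open>x b + k * y b\<close> for some nonnegative
  \<open>k\<close>.\<close>

lemma direction:
  assumes "0 \<le> k"
  obtains t s where "t \<in> T" "0 < s" "\<And>b. \<phi> b t = s * (x b + k * y b)"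
proof -
  let ?h = "\<lambda>t. mu t - k * lam t"
  have "continuous_on {lo..hi} ?h"
    unfolding lam_def mu_def T_eq[symmetric]
    by (intro continuous_intros continuous_on_\<phi>) (simp_all add: wedge_nonzero)
  moreover have "?h lo \<le> 0" "0 \<le> ?h hi"
    using assms by (auto simp: lam_mu_ends)
  ultimately obtain t where t: "t \<in> T" "?h t = 0"
    using IVT'[of ?h lo 0 hi] lo_less_hi by (auto simp: T_eq)
  then have mu: "mu t = k * lam t" by simp
  then have "lam t \<noteq> 0" using lam_mu_pos[OF t(1)] by auto
  with lam_nonneg[OF t(1)] have "0 < lam t" by simp
  moreover have "\<phi> b t = lam t * (x b + k * y b)" for b
    using \<phi>_eq[OF t(1), of b] mu by (simp add: algebra_simps)
  ultimately show thesis using t(1) by (intro that)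
qed

text \<open>Coinciding points give equal virtual values at every type, which
  \<open>screening_env\<close> excludes for distinct bundles.\<close>

lemma same_ends_imp_eq:
  assumes "x b = x b'" "y b = y b'" shows "b = b'"
proof (rule ccontr)
  assume "b \<noteq> b'"
  then obtain t where t: "t \<in> T" "\<phi> b t \<noteq> \<phi> b' t" using \<phi>_distinct by blast
  then show False using \<phi>_eq[OF t(1), of b] \<phi>_eq[OF t(1), of b'] assms by simp
qed

text \<open>Otherwise \<open>\<phi> b\<close> would be positive at the zero of the root. By (R1)
  that zero comes no later than the zero of \<open>b\<close>, so \<open>\<phi> b\<close> would be
  negative, then positive, then zero, against single-crossing.\<close>

lemma root_slope:
  assumes "b \<noteq> {}" "b \<noteq> root"
  shows "x b * y root < x root * y b"
proof (rule ccontr)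
  assume "\<not> ?thesis"
  with not_parallel_root[OF assms] have less: "x root * y b < x b * y root" by simp
  \<comment> \<open>The same zero as in \<open>sold_alone\<close>, so that
    \<open>sold_alone E b = 1 - F (z b)\<close>.\<close>
  define z where "z b = (SOME t. t \<in> T \<and> \<phi> b t = 0)" for b
  have z: "z b \<in> T \<and> \<phi> b (z b) = 0" if "b \<noteq> {}" for b
  proof -
    have "\<exists>t. t \<in> T \<and> \<phi> b t = 0"
      using IVT'[of "\<phi> b" lo 0 hi] \<phi>_lo_neg[OF that] \<phi>_hi_pos[OF that] lo_less_hi
        continuous_on_\<phi>[of b] by (auto simp: T_eq)
    then show ?thesis unfolding z_def by (rule someI_ex)
  qed
  note zr = z[OF root_nonempty] and zb = z[OF assms(1)]
  have "F (z root) < F (z b)"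
    using sold_alone_less[OF assms] by (simp add: sold_alone_def z_def)
  then have "z root \<le> z b"
    using F_strict_mono[of "z b" "z root"] zr zb by force
  moreover have "\<phi> b (z root) > 0"
  proof -
    let ?t = "z root"
    have t: "?t \<in> T" and 0: "lam ?t * x root + mu ?t * y root = 0"
      using zr \<phi>_eq[of ?t root] by auto
    have "lam ?t \<noteq> 0"
      using 0 lam_mu_pos[OF t] \<phi>_hi_pos[OF root_nonempty] by auto
    then have "0 < lam ?t" using lam_nonneg[OF t] by simp
    with less have "lam ?t * (x root * y b) < lam ?t * (x b * y root)" by simp
    \<comment> \<open>The factor \<open>y root\<close> lets the equation
      \<open>\<phi> root ?t = 0\<close> eliminate \<open>mu\<close>.\<close>
    moreover have "y root * \<phi> b ?t = lam ?t * (x b * y root) - lam ?t * (x root * y b)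
        + y b * (lam ?t * x root + mu ?t * y root)"
      unfolding \<phi>_eq[OF t] by (simp add: algebra_simps)
    ultimately have "0 < y root * \<phi> b ?t" using 0 by simp
    then show ?thesis
      using \<phi>_hi_pos[OF root_nonempty] by (simp add: zero_less_mult_iff)
  qed
  moreover have "single_crossing_on T (\<phi> b)"
    using single_crossing2[of 1 b 0 b] by simp
  then have "sgn (x b) \<le> sgn (\<phi> b (z root)) \<and> sgn (\<phi> b (z root)) \<le> sgn (\<phi> b (z b)) \<or>
      sgn (\<phi> b (z b)) \<le> sgn (\<phi> b (z root)) \<and> sgn (\<phi> b (z root)) \<le> sgn (x b)"
    using zr zb \<open>z root \<le> z b\<close> by (intro single_crossing_on_between) (auto simp: T_eq)
  ultimately show False
    using zb \<phi>_lo_neg[OF assms(1)] by auto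
qed

section \<open>Positions of the bundles relative to the root\<close>

lemma y_superset_less: "root \<subseteq> b1 \<Longrightarrow> b1 \<subset> b2 \<Longrightarrow> y b1 < y b2"
  using superset_less by (simp add: \<phi>_hi)

lemma y_root_le: "root \<subseteq> b \<Longrightarrow> y root \<le> y b"
  using y_superset_less[of root b] by (metis less_imp_le order_refl psubsetI)

lemma y_not_superset_less: "\<not> root \<subseteq> b \<Longrightarrow> y b < y root"
  using not_superset_less by (simp add: \<phi>_hi)

text \<open>Compared with the root, \<open>UNIV\<close> has the larger \<open>y\<close> and the more
  negative ratio \<open>x / y\<close>. This makes the denominator at the lowest type in
  \<open>g_between\<close> nonzero.\<close>

lemma x_UNIV_less: "x UNIV < x root"
proof -
  have "x UNIV * y root < x root * y UNIV"
    using root_slope[of UNIV] root_less_UNIV by auto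
  also have "\<dots> < x root * y root"
    using y_superset_less[OF _ root_less_UNIV] \<phi>_lo_neg[OF root_nonempty] by simp
  finally show ?thesis using \<phi>_hi_pos[OF root_nonempty] by simp
qed

lemma x_between:
  assumes "root \<subset> b" "b \<subset> UNIV"
  shows "x b = x root - (x root - x UNIV) * g ((y b - y root) / (y UNIV - y root))"
  using g_between[OF assms] x_UNIV_less by (simp add: field_simps)

definition menu :: "'g set set" where
  "menu = insert {} {b. root \<subseteq> b}"

text \<open>Nested bundles containing the root differ in \<open>y\<close> by assumption.
  Incomparable ones lie strictly between the root and \<open>UNIV\<close>, where \<open>g\<close>
  makes \<open>x\<close> a function of \<open>y\<close>. Breaking ties by \<open>y\<close> therefore
  leaves a single bundle.\<close>

lemma y_inj_on_menu: "inj_on y menu"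
proof -
  have between: "b = b'" if "root \<subset> b" "root \<subset> b'" "b \<subset> UNIV" "b' \<subset> UNIV" "y b = y b'" for b b'
    using that by (intro same_ends_imp_eq) (auto simp: x_between)
  have superset: "b = b'" if "root \<subseteq> b" "root \<subseteq> b'" "y b = y b'" for b b'
  proof (rule ccontr)
    assume "b \<noteq> b'"
    moreover have "\<not> b \<subset> b'" "\<not> b' \<subset> b"
      using y_superset_less[of b b'] y_superset_less[of b' b] that by auto
    ultimately have "root \<subset> b" "root \<subset> b'" "b \<subset> UNIV" "b' \<subset> UNIV"
      using that(1,2) by blast+
    with between[of b b'] that(3) \<open>b \<noteq> b'\<close> show False by simp
  qed
  have "y {} < y b" if "root \<subseteq> b" for b
    using \<phi>_hi_pos[of b] that root_nonempty by (auto simp: \<phi>_empty)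
  then show ?thesis
    using superset unfolding menu_def inj_on_def by (metis insert_iff less_irrefl mem_Collect_eq)
qed

text \<open>After normalising by \<open>y\<close>, the \<open>mu\<close> terms agree and the
  comparison of rays in \<open>root_slope\<close> remains.\<close>

lemma not_menu_\<phi>_le:
  assumes "b \<notin> menu" "t \<in> T"
  shows "y root * \<phi> b t \<le> y b * \<phi> root t"
proof -
  have b: "b \<noteq> {}" "b \<noteq> root" using assms by (auto simp: menu_def)
  have "lam t * (x b * y root) \<le> lam t * (x root * y b)"
    using root_slope[OF b] lam_nonneg[OF assms(2)] by (intro mult_left_mono) auto
  then show ?thesis
    unfolding \<phi>_eq[OF assms(2)] by (simp add: algebra_simps)
qed

text \<open>A bundle outside the menu is beaten by the root, thanks to (R2), when the root has
  nonnegative virtual value, and by the empty bundle otherwise.\<close>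

lemma menu_dominates:
  assumes "t \<in> T" shows "\<exists>b'\<in>menu. \<phi> b t \<le> \<phi> b' t"
proof (cases "b \<in> menu")
  case False
  then have b: "b \<noteq> {}" "\<not> root \<subseteq> b" by (auto simp: menu_def)
  note le = not_menu_\<phi>_le[OF False assms] and pos = \<phi>_hi_pos[OF root_nonempty]
  show ?thesis
  proof (cases "0 \<le> \<phi> root t")
    case True
    have "y b * \<phi> root t \<le> y root * \<phi> root t"
      using y_not_superset_less[OF b(2)] True by (intro mult_right_mono) auto
    with le have "y root * \<phi> b t \<le> y root * \<phi> root t" by simp
    with pos have "\<phi> b t \<le> \<phi> root t" by simp
    then show ?thesis by (auto simp: menu_def)
  next
    case False
    then have "y b * \<phi> root t \<le> 0"
      using \<phi>_hi_pos[OF b(1)] by (intro mult_nonneg_nonpos) auto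
    with le pos have "\<phi> b t \<le> 0" by (metis mult_le_0_iff order_trans not_le)
    then show ?thesis using \<phi>_empty[OF assms] by (auto simp: menu_def)
  qed
qed auto

text \<open>In the direction \<open>k0\<close> where the root has level zero, all other nonempty
  bundles are strictly negative. A slightly larger \<open>k\<close> lifts the root above the empty
  bundle and keeps it ahead of the others.\<close>

lemma strict_max_root:
  obtains t where "t \<in> T" "\<And>b'. b' \<noteq> root \<Longrightarrow> \<phi> b' t < \<phi> root t"
proof -
  note pos = \<phi>_hi_pos[OF root_nonempty]
  define k0 where "k0 = - x root / y root"
  have k0: "x root + k0 * y root = 0" "0 < k0"
    using pos \<phi>_lo_neg[OF root_nonempty] by (simp_all add: k0_def divide_neg_pos)
  have "\<forall>\<^sub>F k in at_right k0. x b' + k * y b' < x root + k * y root" if "b' \<noteq> root" for b'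
  proof (cases "b' = {}")
    case True
    have "0 < x root + k * y root" if "k0 < k" for k
      using k0(1) mult_strict_right_mono[OF that pos] by linarith
    then show ?thesis
      using True eventually_at_right_less[of k0] by (auto simp: \<phi>_empty elim: eventually_mono)
  next
    case False
    have "y root * (x b' + k0 * y b') = x b' * y root + (k0 * y root) * y b'"
      by (simp add: algebra_simps)
    also have "\<dots> = x b' * y root - x root * y b'"
      using k0(1) by (simp add: eq_neg_iff_add_eq_0[symmetric] add.commute)
    also have "\<dots> < 0" using root_slope[OF False that] by simp
    finally have neg: "x b' + k0 * y b' < x root + k0 * y root"
      using pos k0(1) by (simp add: mult_less_0_iff)
    have "((\<lambda>k. (x root + k * y root) - (x b' + k * y b')) \<longlongrightarrow>
        (x root + k0 * y root) - (x b' + k0 * y b')) (at_right k0)"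
      by (intro tendsto_intros)
    from order_tendstoD(1)[OF this, of 0] neg show ?thesis
      by (auto elim: eventually_mono)
  qed
  then have "\<forall>\<^sub>F k in at_right k0. \<forall>b'\<in>- {root}. x b' + k * y b' < x root + k * y root"
    by (intro eventually_ball_finite) auto
  with eventually_at_right_less[of k0]
  have "\<forall>\<^sub>F k in at_right k0. k0 < k \<and> (\<forall>b'\<in>- {root}. x b' + k * y b' < x root + k * y root)"
    by eventually_elim auto
  from eventually_happens'[OF _ this] obtain k where
    "k0 < k" and k: "\<And>b'. b' \<noteq> root \<Longrightarrow> x b' + k * y b' < x root + k * y root"
    by auto
  with k0 have "0 \<le> k" by simp
  then obtain t s where "t \<in> T" "0 < s" "\<And>b. \<phi> b t = s * (x b + k * y b)"
    using direction by metis
  with k show thesis by (intro that[of t]) auto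
qed

text \<open>A supporting line of \<open>g\<close> at the parameter of \<open>b\<close> gives a
  direction in which \<open>b\<close> strictly beats the other bundles containing the root. There
  the root has nonnegative level, so the empty bundle and, by \<open>root_slope\<close> and (R2),
  the bundles not containing the root fall behind too.\<close>

lemma strict_max_between:
  assumes "root \<subset> b" "b \<subset> UNIV"
  obtains t where "t \<in> T" "\<And>b'. b' \<noteq> b \<Longrightarrow> \<phi> b' t < \<phi> b t"
proof -
  note pos = \<phi>_hi_pos[OF root_nonempty]
  define d where "d = x root - x UNIV"
  define e where "e = y UNIV - y root"
  \<comment> \<open>The parameter along the curve: 0 at the root, 1 at \<open>UNIV\<close>.\<close>
  define Y where "Y b = (y b - y root) / e" for b
  have d: "0 < d" using x_UNIV_less by (simp add: d_def)
  have e: "0 < e" using y_superset_less[OF _ root_less_UNIV] by (simp add: e_def)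
  have Y: "0 < Y b'" "Y b' < 1" if "root \<subset> b'" "b' \<subset> UNIV" for b'
    using y_superset_less[of root b'] y_superset_less[of b' UNIV] that e
    by (auto simp: Y_def e_def)
  obtain m where m: "\<And>z. z \<in> {0..1} \<Longrightarrow> z \<noteq> Y b \<Longrightarrow> g (Y b) + m * (z - Y b) < g z"
    using strictly_convex_on_subgradient[OF g_convex Y[OF assms]] by metis
  \<comment> \<open>The supporting inequality at parameter 0, the root.\<close>
  have m0: "g (Y b) < m * Y b"
    using m[of 0] Y[OF assms] by (simp add: g_0)
  have "0 \<le> g (Y b)" using g_range[of "Y b"] Y[OF assms] by simp
  with m0 have "0 < m * Y b" by simp
  then have "0 < m" using Y[OF assms] by (simp add: zero_less_mult_iff)
  \<comment> \<open>The slope \<open>m\<close> converted from coordinates in which \<open>x\<close>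
    is measured in units of \<open>d\<close> and \<open>y\<close> in units of
    \<open>e\<close>.\<close>
  define k where "k = m * d / e"
  have k: "0 < k" using \<open>0 < m\<close> d e by (simp add: k_def)
  define \<psi> where "\<psi> b = x b + k * y b" for b
  have \<psi>_between: "\<psi> b' = \<psi> root + d * (m * Y b' - g (Y b'))" if "root \<subset> b'" "b' \<subset> UNIV" for b'
  proof -
    have "x b' = x root - d * g (Y b')"
      using x_between[OF that] by (simp add: d_def e_def Y_def)
    moreover have "k * (y b' - y root) = d * m * Y b'"
      by (simp add: k_def Y_def)
    ultimately show ?thesis by (simp add: \<psi>_def algebra_simps)
  qed
  have \<psi>_UNIV: "\<psi> UNIV = \<psi> root + d * (m - 1)"
  proof -
    have "k * e = m * d" using e by (simp add: k_def)
    then show ?thesis unfolding \<psi>_def d_def e_def by (simp add: algebra_simps)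
  qed
  have superset: "\<psi> b' < \<psi> b" if sup: "root \<subseteq> b'" "b' \<noteq> b" for b'
  proof -
    consider "b' = root" | "b' = UNIV" | "root \<subset> b'" "b' \<subset> UNIV" using sup by blast
    then show ?thesis
    proof cases
      case 1
      then show ?thesis using \<psi>_between[OF assms] m0 d by simp
    next
      case 2
      \<comment> \<open>\<open>UNIV\<close> has normalised value 1, at least \<open>g 1\<close>, so
        the supporting inequality at parameter 1 covers it.\<close>
      have "g (Y b) + m * (1 - Y b) < g 1" using m[of 1] Y[OF assms] by auto
      then have "m - 1 < m * Y b - g (Y b)"
        using g_range[of 1] by (simp add: algebra_simps)
      then show ?thesis using 2 \<psi>_UNIV \<psi>_between[OF assms] d by simp
    next
      case 3
      have "b' \<in> menu" "b \<in> menu" using sup assms by (auto simp: menu_def)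
      then have "y b' \<noteq> y b" using inj_on_eq_iff[OF y_inj_on_menu] sup by blast
      then have "Y b' \<noteq> Y b" using e by (simp add: Y_def)
      then have "g (Y b) + m * (Y b' - Y b) < g (Y b')" using Y[OF 3] by (intro m) auto
      then have "m * Y b' - g (Y b') < m * Y b - g (Y b)" by (simp add: algebra_simps)
      then show ?thesis using \<psi>_between[OF 3] \<psi>_between[OF assms] d by simp
    qed
  qed
  \<comment> \<open>In a direction where the root is negative, \<open>root_slope\<close> would keep
    \<open>b\<close> below the root.\<close>
  have root_nonneg: "0 \<le> \<psi> root"
  proof (rule ccontr)
    assume "\<not> ?thesis"
    then have kr: "k * y root \<le> - x root" by (simp add: \<psi>_def)
    have "0 < (x b - x root) + k * (y b - y root)"
      using superset[of root] assms by (auto simp: \<psi>_def algebra_simps)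
    then have "0 < y root * ((x b - x root) + k * (y b - y root))" using pos by simp
    also have "\<dots> = y root * (x b - x root) + (k * y root) * (y b - y root)"
      by (simp add: algebra_simps)
    also have "\<dots> \<le> y root * (x b - x root) + (- x root) * (y b - y root)"
      using kr y_root_le[of b] assms by (intro add_left_mono mult_right_mono) auto
    also have "\<dots> = x b * y root - x root * y b" by (simp add: algebra_simps)
    finally show False using root_slope[of b] assms by auto
  qed
  have root_less: "\<psi> root < \<psi> b" using superset[of root] assms by auto
  have "\<psi> b' < \<psi> b" if "b' \<noteq> b" for b'
  proof (cases "b' = {} \<or> root \<subseteq> b'")
    case True
    then show ?thesis
      using superset that root_nonneg root_less by (auto simp: \<psi>_def \<phi>_empty)
  next
    case False
    then have "y root * \<psi> b' = x b' * y root + k * y b' * y root"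
      by (simp add: \<psi>_def algebra_simps)
    also have "\<dots> < x root * y b' + k * y b' * y root"
      using root_slope[of b'] False by auto
    also have "\<dots> = y b' * \<psi> root" by (simp add: \<psi>_def algebra_simps)
    also have "\<dots> \<le> y root * \<psi> root"
      using y_not_superset_less[of b'] False root_nonneg by (intro mult_right_mono) auto
    finally show ?thesis using pos root_less by simp
  qed
  moreover obtain t s where "t \<in> T" "0 < s" "\<And>b. \<phi> b t = s * (x b + k * y b)"
    using direction[OF less_imp_le[OF k]] by metis
  ultimately show thesis by (intro that[of t]) (auto simp: \<psi>_def)
qed

lemma strict_max:
  assumes "b \<in> menu"
  obtains t where "t \<in> T" "\<And>b'. b' \<noteq> b \<Longrightarrow> \<phi> b' t < \<phi> b t"
proof -
  consider "b = {}" | "b = root" | "root \<subset> b" "b \<subset> UNIV" | "b = UNIV"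
    using assms by (auto simp: menu_def)
  then show thesis
  proof cases
    case 1
    then show thesis using \<phi>_lo_neg by (intro that[of lo]) (auto simp: \<phi>_empty)
  next
    case 2
    then show thesis using strict_max_root that by blast
  next
    case 3
    then show thesis using strict_max_between that by blast
  next
    case 4
    have "y b' < y UNIV" if "b' \<noteq> UNIV" for b'
      using y_superset_less[of b' UNIV] y_not_superset_less[of b'] y_root_le[of UNIV] that
      by (cases "root \<subseteq> b'") auto
    with 4 show thesis by (intro that[of hi]) auto
  qed
qed

end

section \<open>The optimal mechanism\<close>

context tree_screening
begin

text \<open>Ties in the virtual value are broken towards the larger value at the highest type.\<close>

definition selected :: "real \<Rightarrow> 'g set \<Rightarrow> bool" where
  "selected t b \<longleftrightarrow> b \<in> menu \<and>
     (\<forall>b'\<in>menu. \<phi> b' t < \<phi> b t \<or> \<phi> b' t = \<phi> b t \<and> y b' \<le> y b)"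

definition choice :: "real \<Rightarrow> 'g set" where
  "choice t = (SOME b. selected t b)"

lemma choice_selected: "selected t (choice t)"
proof -
  have "menu \<noteq> {}" by (simp add: menu_def)
  from ex_lexicographic_max[OF _ this, of "\<lambda>b. \<phi> b t" y] have "\<exists>b. selected t b"
    unfolding selected_def by auto
  then show ?thesis unfolding choice_def by (rule someI_ex)
qed

lemma choice_in_menu: "choice t \<in> menu"
  using choice_selected by (simp add: selected_def)

text \<open>Two selected bundles tie in \<open>y\<close> and hence coincide. Measurability of the
  choice thus reduces to that of finitely many comparisons.\<close>

lemma choice_eq_iff: "choice t = b \<longleftrightarrow> selected t b"
proof
  assume b: "selected t b"
  then have "y (choice t) \<le> y b" "y b \<le> y (choice t)"
    using choice_selected[of t] unfolding selected_def by fastforce+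
  then show "choice t = b"
    using b choice_in_menu inj_onD[OF y_inj_on_menu] unfolding selected_def by (meson antisym)
qed (use choice_selected in auto)

lemma choice_max:
  assumes "t \<in> T" shows "\<phi> b t \<le> \<phi> (choice t) t"
proof -
  obtain b' where "b' \<in> menu" "\<phi> b t \<le> \<phi> b' t" using menu_dominates[OF assms] by blast
  then show ?thesis using choice_selected[of t] unfolding selected_def by fastforce
qed

lemma choice_lo: "choice lo = {}"
  using choice_max[OF lo_in_T, of "{}"] \<phi>_lo_neg[of "choice lo"] \<phi>_empty[OF lo_in_T] by force

lemma choice_measurable:
  "(\<lambda>t. pmf (return_pmf (choice t)) b) \<in> borel_measurable (restrict_space borel T)"
proof -
  have [measurable]: "\<phi> b \<in> borel_measurable (restrict_space borel T)" for b
    by (rule measurable_T[OF continuous_on_\<phi>])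
  have "Measurable.pred (restrict_space borel T) (\<lambda>t. selected t b)"
    unfolding selected_def by measurable
  then have "(\<lambda>t. if selected t b then 1 else 0 :: real) \<in> borel_measurable (restrict_space borel T)"
    by measurable
  moreover have "pmf (return_pmf (choice t)) b = (if selected t b then 1 else 0)" for t
    by (auto simp: choice_eq_iff[symmetric])
  ultimately show ?thesis by simp
qed

text \<open>By (A1) the increment is monotonic. If it decreased, its derivative at \<open>s\<close>
  would be nonpositive, so the virtual increment at \<open>s\<close> would be at least the increment
  at \<open>s\<close>, hence at least that at \<open>hi\<close>. The latter is positive since the
  choice moves towards larger \<open>y\<close>, whereas \<open>choice s\<close> maximises the
  virtual value at \<open>s\<close>.\<close>

lemma choice_increment_mono:
  assumes st: "s \<in> T" "t \<in> T" "s < t"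
  shows "mono_on T (\<lambda>r. v (choice t) r - v (choice s) r)"
proof (cases "choice s = choice t")
  case False
  define b b' where "b = choice s" and "b' = choice t"
  have "\<phi> b' s - \<phi> b s \<le> 0" using choice_max[OF st(1)] by (simp add: b_def)
  have b: "b \<in> menu" "b' \<in> menu" "b \<noteq> b'"
    using choice_in_menu False by (auto simp: b_def b'_def)
  have y: "y b < y b'"
  proof (cases "\<phi> b t < \<phi> b' t")
    case True
    \<comment> \<open>A difference that is nonpositive at \<open>s\<close> and positive at
      \<open>t\<close> has increasing sign, so it is still positive at \<open>hi\<close>.\<close>
    then have "0 < \<phi> b' hi - \<phi> b hi"
      using single_crossing_on_between[OF single_crossing st(1,2) hi_in_T, of b' b]
        \<open>\<phi> b' s - \<phi> b s \<le> 0\<close> st by (auto simp: T_eq sgn_if split: if_splits)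
    then show ?thesis by simp
  next
    case False
    \<comment> \<open>A tie at \<open>t\<close>, broken in favour of the larger
      \<open>y\<close>.\<close>
    then have "y b \<le> y b'"
      using choice_selected[of t] b unfolding selected_def b'_def[symmetric] by blast
    moreover have "y b \<noteq> y b'" using inj_on_eq_iff[OF y_inj_on_menu] b by blast
    ultimately show ?thesis by simp
  qed
  define w where "w r = v b' r - v b r" for r
  have "\<not> antimono_on T w"
  proof
    assume anti: "antimono_on T w"
    have "mono_on {lo..hi} (\<lambda>r. - w r)"
      using anti by (auto simp: monotone_on_def T_eq)
    moreover have "((\<lambda>r. - w r) has_real_derivative - (v' b' s - v' b s)) (at s within {lo..hi})"
      unfolding w_def T_eq[symmetric] by (intro DERIV_minus DERIV_diff v_deriv st)
    ultimately have "0 \<le> - (v' b' s - v' b s)"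
      using lo_less_hi st by (intro mono_on_imp_derivative_nonneg) (auto simp: T_eq)
    moreover define \<kappa> where "\<kappa> = (1 - F s) / dens s"
    then have "0 \<le> \<kappa>" using F_bounds[OF st(1)] dens_pos[OF st(1)] by simp
    ultimately have "\<kappa> * (v' b' s - v' b s) \<le> 0" by (intro mult_nonneg_nonpos) auto
    moreover have "\<phi> b s = v b s - \<kappa> * v' b s" "\<phi> b' s = v b' s - \<kappa> * v' b' s"
      by (simp_all add: virtual_val_def \<kappa>_def)
    ultimately have "w s \<le> \<phi> b' s - \<phi> b s"
      unfolding w_def right_diff_distrib by linarith
    moreover have "w hi \<le> w s"
      using anti st by (auto simp: monotone_on_def T_eq)
    ultimately show False
      using y \<open>\<phi> b' s - \<phi> b s \<le> 0\<close> by (simp add: w_def \<phi>_hi)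
  qed
  then show ?thesis
    using monotonic[of b' b] unfolding monotonic_on_def w_def b_def b'_def by blast
qed (simp add: monotone_on_def)

lemma choice_v'_mono:
  assumes "s \<in> T" "t \<in> T" "s \<le> t" "r \<in> T"
  shows "v' (choice s) r \<le> v' (choice t) r"
proof (cases "s = t")
  case False
  have "((\<lambda>r. v (choice t) r - v (choice s) r) has_real_derivative
      v' (choice t) r - v' (choice s) r) (at r within {lo..hi})"
    unfolding T_eq[symmetric] by (intro DERIV_diff v_deriv assms)
  moreover have "mono_on {lo..hi} (\<lambda>r. v (choice t) r - v (choice s) r)"
    using choice_increment_mono[of s t] assms False by (simp add: T_eq)
  ultimately have "0 \<le> v' (choice t) r - v' (choice s) r"
    using lo_less_hi assms by (intro mono_on_imp_derivative_nonneg) (auto simp: T_eq)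
  then show ?thesis by simp
qed simp

text \<open>The indirect utility given by the envelope formula, with the lowest type at
  zero.\<close>

definition utility :: "real \<Rightarrow> real" where
  "utility t = integral {lo..t} (\<lambda>s. v' (choice s) s)"

definition price :: "real \<Rightarrow> real" where
  "price t = v (choice t) t - utility t"

lemma choice_v'_integrable: "set_integrable lborel T (\<lambda>s. v' (choice s) s)"
  using set_integrable_lottery[of "\<lambda>t. return_pmf (choice t)" v', OF choice_measurable continuous_on_v']
  by simp

text \<open>This is incentive compatibility of type \<open>t\<close> against the report
  \<open>s\<close>: both sides are integrals between the two types, and
  \<open>choice_v'_mono\<close> orders the integrands.\<close>

lemma utility_diff_ge:
  assumes "s \<in> T" "t \<in> T"
  shows "v (choice s) t - v (choice s) s \<le> utility t - utility s"
proof -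
  have int: "(\<lambda>s. v' (choice s) s) integrable_on {c..d}" if "c \<in> T" "d \<in> T" for c d
    using set_borel_integral_eq_integral(1)[OF choice_v'_integrable] that
    by (rule_tac integrable_subinterval_real[of _ lo hi]) (auto simp: T_eq)
  have combine: "utility c + integral {c..d} (\<lambda>s. v' (choice s) s) = utility d"
    if "c \<in> T" "d \<in> T" "c \<le> d" for c d
    unfolding utility_def using that
    by (intro Henstock_Kurzweil_Integration.integral_combine int) (auto simp: T_eq)
  have ftc: "(v' b has_integral v b d - v b c) {c..d}" if "c \<in> T" "d \<in> T" "c \<le> d" for b c d
    using that by (intro fundamental_theorem_of_calculus)
      (auto simp: has_real_derivative_iff_has_vector_derivative[symmetric] T_eq
        intro!: has_field_derivative_subset[OF v_deriv[unfolded T_eq]])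
  show ?thesis
  proof (cases "s \<le> t")
    case True
    have "v (choice s) t - v (choice s) s \<le> integral {s..t} (\<lambda>r. v' (choice r) r)"
    proof (rule has_integral_le[OF ftc[OF assms True] integrable_integral[OF int[OF assms]]])
      fix r assume "r \<in> {s..t}"
      then show "v' (choice s) r \<le> v' (choice r) r"
        using assms by (intro choice_v'_mono) (auto simp: T_eq)
    qed
    then show ?thesis using combine[OF assms True] by simp
  next
    case False
    then have ts: "t \<le> s" by simp
    have "integral {t..s} (\<lambda>r. v' (choice r) r) \<le> v (choice s) s - v (choice s) t"
    proof (rule has_integral_le[OF integrable_integral[OF int[OF assms(2,1)]] ftc[OF assms(2,1) ts]])
      fix r assume "r \<in> {t..s}"
      then show "v' (choice r) r \<le> v' (choice s) r"
        using assms by (intro choice_v'_mono) (auto simp: T_eq)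
    qed
    then show ?thesis using combine[OF assms(2,1) ts] by simp
  qed
qed

lemma choice_feasible: "feasible E (\<lambda>t. return_pmf (choice t)) price"
proof -
  have ic: "v (choice t) s - price t \<le> utility s" if "s \<in> T" "t \<in> T" for s t
    using utility_diff_ge[OF that(2,1)] by (simp add: price_def)
  have "utility lo = 0" by (simp add: utility_def)
  \<comment> \<open>Every type can report the lowest one, which gets the empty bundle at price
    zero.\<close>
  then have ir: "0 \<le> utility t" if "t \<in> T" for t
    using ic[OF that lo_in_T] that by (simp add: price_def choice_lo v_empty)
  have "continuous_on T utility"
    unfolding utility_def T_eq
    using set_borel_integral_eq_integral(1)[OF choice_v'_integrable]
    by (intro indefinite_integral_continuous_1) (simp add: T_eq)
  moreover have "(\<lambda>t. v (choice t) t) \<in> borel_measurable (restrict_space borel T)"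
    using lottery_measurable[of "\<lambda>t. return_pmf (choice t)" v, OF choice_measurable continuous_on_v]
    by simp
  ultimately have "price \<in> borel_measurable (restrict_space borel T)"
    unfolding price_def by (simp add: borel_measurable_diff measurable_T)
  then show ?thesis
    using ic ir choice_measurable
    by (simp add: feasible_def mechanism_def incentive_compatible_def individually_rational_def
        price_def)
qed

section \<open>Optimality of the choice and minimality of its menu\<close>

lemma revenue_price: "revenue E price = (LINT t:T|lborel. \<phi> (choice t) t * dens t)"
  using revenue_eq_virtual_surplus[OF choice_feasible]
  by (simp add: price_def utility_def)

lemma revenue_le_virtual_surplus:
  assumes "feasible E a p"
  shows "revenue E p \<le> (LINT t:T|lborel. lottery \<phi> (a t) t * dens t)"
  using revenue_eq_virtual_surplus[OF assms] assms
  by (simp add: feasible_def individually_rational_def)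

text \<open>Virtual surplus bounds the revenue of every feasible mechanism, \<open>choice\<close>
  maximises it at each type, and \<open>price\<close> attains the bound because it leaves the lowest
  type no utility.\<close>

lemma choice_optimal: "optimal_mechanism E (\<lambda>t. return_pmf (choice t)) price"
  unfolding optimal_mechanism_def
proof (intro conjI allI impI choice_feasible)
  fix a p assume ap: "feasible E a p"
  have "(LINT t:T|lborel. lottery \<phi> (a t) t * dens t) \<le> (LINT t:T|lborel. \<phi> (choice t) t * dens t)"
  proof (rule set_integral_mono[OF surplus_integrable[OF ap]])
    show "set_integrable lborel T (\<lambda>t. \<phi> (choice t) t * dens t)"
      using surplus_integrable[OF choice_feasible] by simp
    show "lottery \<phi> (a t) t * dens t \<le> \<phi> (choice t) t * dens t" if "t \<in> T" for t
      using dens_pos[OF that] choice_max[OF that] by (intro mult_right_mono lottery_le) auto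
  qed
  then show "revenue E p \<le> revenue E price"
    using revenue_le_virtual_surplus[OF ap] by (simp add: revenue_price)
qed

lemma menu_optimal: "optimal_menu E menu"
  unfolding optimal_menu_def using choice_optimal choice_in_menu by blast

text \<open>Without \<open>b\<close>, a mechanism would lose virtual surplus on a whole interval of
  types around the one at which \<open>b\<close> is the strict maximiser.\<close>

lemma menu_subset_optimal_menu:
  assumes "optimal_menu E B" shows "menu \<subseteq> B"
proof
  fix b assume b: "b \<in> menu"
  show "b \<in> B"
  proof (rule ccontr)
    assume "b \<notin> B"
    obtain a p where opt: "optimal_mechanism E a p" and aB: "\<And>t. t \<in> T \<Longrightarrow> \<exists>b\<in>B. a t = return_pmf b"
      using assms unfolding optimal_menu_def by blast
    then have feas: "feasible E a p" by (simp add: optimal_mechanism_def)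
    \<comment> \<open>The pointwise loss of virtual surplus against \<open>choice\<close>:
      nonnegative, yet with nonpositive integral by optimality of \<open>p\<close>.\<close>
    define h where "h t = \<phi> (choice t) t * dens t - lottery \<phi> (a t) t * dens t" for t
    have hint: "set_integrable lborel T h"
      unfolding h_def using surplus_integrable[OF choice_feasible] surplus_integrable[OF feas]
      by (intro set_integral_diff) simp_all
    have "(LINT t:T|lborel. h t) = revenue E price - (LINT t:T|lborel. lottery \<phi> (a t) t * dens t)"
      unfolding h_def revenue_price
      using surplus_integrable[OF choice_feasible] surplus_integrable[OF feas]
      by (intro set_integral_diff) simp_all
    moreover have "revenue E price \<le> revenue E p"
      using opt choice_feasible by (simp add: optimal_mechanism_def)
    ultimately have "(LINT t:T|lborel. h t) \<le> 0"
      using revenue_le_virtual_surplus[OF feas] by simp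
    then have le0: "integral T h \<le> 0"
      using set_borel_integral_eq_integral(2)[OF hint] by simp
    have h0: "0 \<le> h t" if "t \<in> T" for t
      using dens_pos[OF that] choice_max[OF that]
      by (auto simp: h_def intro!: mult_right_mono lottery_le)
    obtain t0 where t0: "t0 \<in> T" "\<And>b'. b' \<noteq> b \<Longrightarrow> \<phi> b' t0 < \<phi> b t0"
      using strict_max[OF b] by metis
    have "\<forall>\<^sub>F \<delta> in at_right 0. \<delta> < dens t0 * (\<phi> b t0 - \<phi> b' t0)" if "b' \<in> - {b}" for b'
      using t0 dens_pos that by (intro order_tendstoD(2)[OF tendsto_ident_at]) simp
    then have "\<forall>\<^sub>F \<delta> in at_right 0. \<forall>b'\<in>- {b}. \<delta> < dens t0 * (\<phi> b t0 - \<phi> b' t0)"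
      by (intro eventually_ball_finite) auto
    with eventually_at_right_less[of 0]
    have "\<forall>\<^sub>F \<delta> in at_right (0::real). 0 < \<delta> \<and> (\<forall>b'\<in>- {b}. \<delta> < dens t0 * (\<phi> b t0 - \<phi> b' t0))"
      by eventually_elim auto
    \<comment> \<open>Strictly below each of the finitely many gaps at \<open>t0\<close>, so that by
      continuity it stays below them nearby.\<close>
    from eventually_happens'[OF _ this] obtain \<delta> where \<delta>: "0 < \<delta>"
      "\<forall>b'\<in>- {b}. \<delta> < dens t0 * (\<phi> b t0 - \<phi> b' t0)"
      by auto
    have "\<forall>\<^sub>F t in at t0 within T. \<delta> < dens t * (\<phi> b t - \<phi> b' t)" if "b' \<in> - {b}" for b'
    proof (rule order_tendstoD(1))
      have "continuous_on T (\<lambda>t. dens t * (\<phi> b t - \<phi> b' t))"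
        by (intro continuous_intros continuous_on_dens continuous_on_\<phi>)
      then show "((\<lambda>t. dens t * (\<phi> b t - \<phi> b' t)) \<longlongrightarrow> dens t0 * (\<phi> b t0 - \<phi> b' t0)) (at t0 within T)"
        using t0(1) by (simp add: continuous_on)
    qed (use \<delta> that in blast)
    then have ev: "\<forall>\<^sub>F t in at t0 within {lo..hi}. \<forall>b'\<in>- {b}. \<delta> < dens t * (\<phi> b t - \<phi> b' t)"
      unfolding T_eq by (intro eventually_ball_finite) auto
    obtain c d where cd: "c < d" "{c..d} \<subseteq> T"
      and gap: "\<And>t. t \<in> {c..d} \<Longrightarrow> \<forall>b'\<in>- {b}. \<delta> < dens t * (\<phi> b t - \<phi> b' t)"
      by (rule interval_of_eventually_within[OF lo_less_hi t0(1)[unfolded T_eq] ev \<delta>(2),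
            folded T_eq]) (rule that)
    have h\<delta>: "\<delta> \<le> h t" if "t \<in> {c..d}" for t
    proof -
      have t: "t \<in> T" using that cd by blast
      then obtain b' where "b' \<in> B" "a t = return_pmf b'" using aB by blast
      then have "h t = dens t * (\<phi> (choice t) t - \<phi> b' t)" "b' \<in> - {b}"
        using \<open>b \<notin> B\<close> by (auto simp: h_def algebra_simps)
      moreover have "dens t * (\<phi> b t - \<phi> b' t) \<le> dens t * (\<phi> (choice t) t - \<phi> b' t)"
        using dens_pos[OF t] choice_max[OF t] by simp
      ultimately show ?thesis using gap[OF that] by force
    qed
    have hT: "h integrable_on T"
      using set_borel_integral_eq_integral(1)[OF hint] .
    have hcd: "h integrable_on {c..d}"
      using hT cd(2) unfolding T_eq by (rule integrable_subinterval_real)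
    have "0 < \<delta> * (d - c)" using \<delta> cd by simp
    also have "\<dots> = integral {c..d} (\<lambda>_. \<delta>)" using cd by simp
    also have "\<dots> \<le> integral {c..d} h"
      by (rule integral_le[OF integrable_const_ivl hcd h\<delta>])
    also have "\<dots> \<le> integral T h"
      using cd(2) hcd hT h0 by (intro integral_subset_le) auto
    finally show False using le0 by simp
  qed
qed

text \<open>Being optimal and contained in every optimal menu, \<open>menu\<close> is the least
  optimal menu.\<close>

lemma minimal_optimal_menu_iff: "minimal_optimal_menu E B \<longleftrightarrow> B = menu"
  unfolding minimal_optimal_menu_def
  using menu_optimal menu_subset_optimal_menu by (metis psubset_eq subset_antisym)

text \<open>With at most one good outside the root, no bundle would lie strictly between the root
  and \<open>UNIV\<close>. Adding two different outside goods to the root separately gives the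
  incomparable pair.\<close>

lemma tree_menu_menu: "tree_menu menu"
proof -
  have "\<not> (\<exists>i. UNIV - root \<subseteq> {i})"
  proof
    assume "\<exists>i. UNIV - root \<subseteq> {i}"
    then have "{b. root \<subset> b \<and> b \<subset> UNIV} = {}" by auto
    then have "card {b. root \<subset> b \<and> b \<subset> UNIV} = 0" by (simp only: card.empty)
    then show False using card_between by linarith
  qed
  moreover obtain i where "i \<notin> root" using root_less_UNIV by blast
  ultimately obtain i j where "i \<notin> root" "j \<notin> root" "i \<noteq> j" by blast
  then have "insert i root \<in> menu" "insert j root \<in> menu"
    "\<not> insert i root \<subseteq> insert j root" "\<not> insert j root \<subseteq> insert i root"
    by (auto simp: menu_def)
  then show ?thesis
    unfolding tree_menu_def using root_nonempty by (auto simp: menu_def)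
qed

end

theorem theorem3:
  fixes E :: "'g::finite screening" and root :: "'g set"
  assumes "screening_env E"
    and A1: "\<forall>b b'. single_crossing_on (types E) (\<lambda>t. virtual_val E b t - virtual_val E b' t) \<and>
                    monotonic_on (types E) (\<lambda>t. val E b t - val E b' t)"
    and A2: "\<forall>a a'. single_crossing_on (types E)
                      (\<lambda>t. lottery (virtual_val E) a t - lottery (virtual_val E) a' t)"
    and R1: "{root} = argmax_sold_alone E"
    and R2: "\<forall>b. \<not> root \<subseteq> b \<longrightarrow> val E b (type_hi E) < val E root (type_hi E)"
    and "\<forall>b1 b2. root \<subseteq> b1 \<and> b1 \<subset> b2 \<and> b2 \<subseteq> UNIV \<longrightarrow>
           val E b1 (type_hi E) < val E b2 (type_hi E)"
    and "card {b. root \<subset> b \<and> b \<subset> UNIV} \<ge> 2"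
    and "\<exists>g :: real \<Rightarrow> real.
           g \<in> {0..1} \<rightarrow> {0..1} \<and> g 0 = 0 \<and> mono_on {0..1} g \<and> strictly_convex_on {0..1} g \<and>
           (\<forall>b. root \<subset> b \<and> b \<subset> UNIV \<longrightarrow>
              (virtual_val E b (type_lo E) - virtual_val E root (type_lo E)) /
                (virtual_val E UNIV (type_lo E) - virtual_val E root (type_lo E)) =
              g ((virtual_val E b (type_hi E) - virtual_val E root (type_hi E)) /
                 (virtual_val E UNIV (type_hi E) - virtual_val E root (type_hi E))))"
  shows "\<exists>B. (\<forall>B'. minimal_optimal_menu E B' \<longleftrightarrow> B' = B) \<and> tree_menu B"
proof -
  from assms(8) obtain g :: "real \<Rightarrow> real" where g: "g \<in> {0..1} \<rightarrow> {0..1}" "g 0 = 0"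
    "strictly_convex_on {0..1} g"
    "\<forall>b. root \<subset> b \<and> b \<subset> UNIV \<longrightarrow>
      (virtual_val E b (type_lo E) - virtual_val E root (type_lo E)) /
        (virtual_val E UNIV (type_lo E) - virtual_val E root (type_lo E)) =
      g ((virtual_val E b (type_hi E) - virtual_val E root (type_hi E)) /
         (virtual_val E UNIV (type_hi E) - virtual_val E root (type_hi E)))"
    by (elim exE conjE) (rule that)
  interpret tree_screening E root g
  proof
    fix b b' b1 b2 :: "'g set" and z :: real
    show "screening_env E" by fact
    show "single_crossing_on (types E) (\<lambda>t. virtual_val E b t - virtual_val E b' t)"
      and "monotonic_on (types E) (\<lambda>t. val E b t - val E b' t)"
      using A1 by blast+
    show "z \<in> {0..1} \<Longrightarrow> g z \<in> {0..1}" using g(1) by blast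
    show "root \<subseteq> b1 \<Longrightarrow> b1 \<subset> b2 \<Longrightarrow> val E b1 (type_hi E) < val E b2 (type_hi E)"
      using assms(6) by blast
  qed (use A2 R1 R2 assms(7) g(2-4) in blast)+
  show ?thesis using minimal_optimal_menu_iff tree_menu_menu by blast
qed

end
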